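(* Let $c=a+bi\in\mathbb C$ with $a,b\in\mathbb R$. The set $R(c)=\{\sigma_c(n)\colon n\in\mathbb N\}$ is dense in $\mathbb C$ if and only if $-1\leq a\leq 0$ and $b\neq 0$.
   Context: $\mathbb N$ is the set of positive integers. For $c\in\mathbb C$, the divisor function $\sigma_c\colon\mathbb N\to\mathbb C$ is $\sigma_c(n)=\sum_{d\mid n}d^c$ (sum over positive divisors $d$ of $n$), where $d^c=e^{c\log d}$ with the real logarithm $\log d$. *)

theory Defs
  imports "HOL-Analysis.Analysis"
begin

definition divisor_sigma :: "complex \<Rightarrow> nat \<Rightarrow> complex" where
  "divisor_sigma c n = (\<Sum>d | d dvd n. exp (c * complex_of_real (ln (real d))))"

(* The value at n = 0 is meaningless (infinite sum); only positive n are used. *)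
definition sigma_range :: "complex \<Rightarrow> complex set" where
  "sigma_range c = {divisor_sigma c n |n. n > 0}"

lemma divisor_sigma_powr:
  assumes "n > 0"
  shows "divisor_sigma c n = (\<Sum>d | d dvd n. of_nat d powr c)"
  unfolding divisor_sigma_def
proof (rule sum.cong)
  fix d assume "d \<in> {d. d dvd n}"
  then have "d > 0" using assms by (auto intro: Nat.gr0I)
  then show "exp (c * complex_of_real (ln (real d))) = of_nat d powr c"
    by (simp add: powr_def Ln_of_nat)
qed simp

end

theory Submission
  imports Defs "HOL-Complex_Analysis.Complex_Analysis"
begin

text \<open>
  Write \<open>c = a + b \<i>\<close>. The obstructions to density are elementary: for \<open>b = 0\<close> all values are
  real; for \<open>a < -1\<close> they are bounded by the convergent series \<open>\<Sum> d powr a\<close>; for \<open>a > 0\<close> the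
  estimate \<open>\<bar>\<sigma>(p^k)\<bar> \<ge> x^k (x - 1) / (x + 1)\<close> with \<open>x = p powr a\<close> and multiplicativity give
  \<open>\<bar>\<sigma>(n)\<bar> \<longlonglongrightarrow> \<infinity>\<close>, so that a ball contains only finitely many values
  (\<open>norm_divisor_sigma_at_top\<close>).

  In the remaining case already the squarefree \<open>n\<close> suffice, where \<open>\<sigma>(n)\<close> is the product of
  \<open>1 + p powr c\<close> over the primes \<open>p\<close> dividing \<open>n\<close>. Here \<open>p powr c\<close> has modulus \<open>p powr a \<ge> 1 / p\<close>
  and direction \<open>p powr (b \<i>)\<close>, and everything rests on the fact that for every arc of the unit
  circle the primes with direction in that arc have a divergent sum of reciprocals
  (\<open>prime_arc_divergence\<close>). If \<open>a < 0\<close>, the factors tend to 1. To reach \<open>z = exp \<zeta>\<close> choose primes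
  whose direction is almost that of \<open>\<zeta>\<close>; the numbers \<open>Ln (1 + p powr c)\<close> are then almost positive
  multiples of \<open>\<zeta>\<close>, arbitrarily short, with a divergent sum of lengths, so some finite sum of them
  is close to \<open>\<zeta>\<close>. If \<open>a = 0\<close>, the factors come close to \<open>1 + w\<close> for each \<open>w\<close> on the unit circle, and every
  nonzero complex number is a finite product of such \<open>1 + w\<close>.

  The divergence statement is a weak equidistribution theorem, proved as in Dirichlet's theorem on
  primes in progressions. The Euler product shows that \<open>\<Sum> p powr (-s)\<close> differs from a logarithm of
  the zeta function by a bounded amount for \<open>Re s > 1\<close>. Zeta has a pole at 1, and it is holomorphic
  and, by the 3-4-1 inequality, nonzero at the other points of the line \<open>Re s = 1\<close>. Hence, as
  \<open>\<sigma>\<close> decreases to 1, the sum \<open>\<Sum> p powr (-\<sigma>)\<close> diverges while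
  \<open>\<Sum> p powr (-\<sigma>) * p powr (-\<i> t)\<close> stays bounded for every \<open>t \<noteq> 0\<close>. Thus the mean of a
  trigonometric polynomial over the directions \<open>p powr (b \<i>)\<close>, weighted by \<open>p powr (-\<sigma>)\<close>, tends to
  its constant term. For the polynomial \<open>((1 + cos x) / 2)^N\<close> with large \<open>N\<close> this constant term
  exceeds the maximum outside an arc around 0, so the primes in the arc cannot have a convergent
  sum of reciprocals.
\<close>

section \<open>The logarithm of the zeta function as a sum over primes\<close>

text \<open>Locally uniform limits of holomorphic functions are holomorphic; the Weierstrass test makes
  the partial sums over finite subsets converge uniformly on a closed ball around each point.\<close>
lemma holomorphic_on_infsum:
  fixes f :: "'a \<Rightarrow> complex \<Rightarrow> complex"
  assumes "open U" and holo: "\<And>x. x \<in> X \<Longrightarrow> f x holomorphic_on U"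
    and bound: "\<And>z. z \<in> U \<Longrightarrow> \<exists>r>0. cball z r \<subseteq> U \<and>
      (\<exists>M. M summable_on X \<and> (\<forall>x\<in>X. \<forall>y\<in>cball z r. norm (f x y) \<le> M x))"
  shows "(\<lambda>z. \<Sum>\<^sub>\<infinity>x\<in>X. f x z) holomorphic_on U"
proof -
  have "(\<lambda>z. \<Sum>\<^sub>\<infinity>x\<in>X. f x z) field_differentiable (at z)" if z: "z \<in> U" for z
  proof -
    obtain r M where r: "r > 0" "cball z r \<subseteq> U" and M: "M summable_on X"
      "\<And>x y. x \<in> X \<Longrightarrow> y \<in> cball z r \<Longrightarrow> norm (f x y) \<le> M x"
      using bound[OF z] by blast
    have ul: "uniform_limit (cball z r) (\<lambda>F y. \<Sum>x\<in>F. f x y) (\<lambda>y. \<Sum>\<^sub>\<infinity>x\<in>X. f x y)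
        (finite_subsets_at_top X)"
      by (rule Weierstrass_m_test_general[OF M(2,1)])
    have ev: "\<forall>\<^sub>F F in finite_subsets_at_top X. continuous_on (cball z r) (\<lambda>y. \<Sum>x\<in>F. f x y) \<and>
        (\<lambda>y. \<Sum>x\<in>F. f x y) holomorphic_on ball z r"
      unfolding eventually_finite_subsets_at_top
    proof (intro exI[of _ "{}"] conjI allI impI)
      fix F assume F: "finite F \<and> {} \<subseteq> F \<and> F \<subseteq> X"
      have "(\<lambda>y. \<Sum>x\<in>F. f x y) holomorphic_on U"
        using F holo by (intro holomorphic_on_sum) auto
      then show "continuous_on (cball z r) (\<lambda>y. \<Sum>x\<in>F. f x y)"
        "(\<lambda>y. \<Sum>x\<in>F. f x y) holomorphic_on ball z r"
        using r ball_subset_cball[of z r]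
        by (blast intro: holomorphic_on_imp_continuous_on holomorphic_on_subset)+
    qed auto
    obtain "(\<lambda>y. \<Sum>\<^sub>\<infinity>x\<in>X. f x y) holomorphic_on ball z r"
      using holomorphic_uniform_limit[OF ev ul] by auto
    then show ?thesis using r(1)
      by (meson centre_in_ball holomorphic_on_imp_differentiable_at open_ball)
  qed
  then show ?thesis
    by (simp add: holomorphic_on_def field_differentiable_at_within)
qed

text \<open>Summation over all of \<^typ>\<open>nat\<close> adds nothing to the usual series, because
  \<open>0 powr (-s) = 0\<close>.\<close>
definition zeta :: "complex \<Rightarrow> complex" where
  "zeta s = (\<Sum>\<^sub>\<infinity>n::nat. of_nat n powr (-s))"

definition prime_zeta :: "complex \<Rightarrow> complex" where
  "prime_zeta s = (\<Sum>\<^sub>\<infinity>p\<in>{p::nat. prime p}. of_nat p powr (-s))"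

text \<open>The branch of the logarithm of \<open>zeta\<close> that the Euler product provides.\<close>
definition log_zeta :: "complex \<Rightarrow> complex" where
  "log_zeta s = (\<Sum>\<^sub>\<infinity>p\<in>{p::nat. prime p}. - Ln (1 - of_nat p powr (-s)))"

lemma norm_nat_powr: "norm (of_nat n powr s :: complex) = real n powr Re s"
  using norm_powr_real_powr[of "of_nat n" s] by (cases "n = 0") auto

lemma real_powr_summable_on:
  assumes "\<sigma> > 1"
  shows "(\<lambda>n. real n powr (-\<sigma>)) summable_on A"
proof -
  have "(\<lambda>n. real n powr (-\<sigma>)) summable_on UNIV"
    using assms by (subst summable_on_UNIV_nonneg_real_iff) (auto simp: summable_real_powr_iff)
  then show ?thesis by (rule summable_on_subset_banach) auto
qed

lemma nat_powr_abs_summable_on: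
  assumes "Re s > 1"
  shows "(\<lambda>n. norm (of_nat n powr (-s) :: complex)) summable_on A"
  using real_powr_summable_on[OF assms, of A] by (simp add: norm_nat_powr)

lemma nat_powr_summable_on:
  assumes "Re s > 1"
  shows "(\<lambda>n. of_nat n powr (-s) :: complex) summable_on A"
  using nat_powr_abs_summable_on[OF assms] by (rule abs_summable_summable)

text \<open>Sieve of Eratosthenes: multiplying by \<open>1 - q powr (-s)\<close> removes the terms whose index is
  divisible by \<open>q\<close>, because \<open>n \<mapsto> q * n\<close> maps the indices that survived the earlier primes
  bijectively onto the multiples of \<open>q\<close> among them.\<close>
lemma euler_sieve:
  assumes "Re s > 1" "finite A" "\<And>p. p \<in> A \<Longrightarrow> prime p"
  shows "zeta s * (\<Prod>p\<in>A. 1 - of_nat p powr (-s)) =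
    (\<Sum>\<^sub>\<infinity>n\<in>{n::nat. n > 0 \<and> (\<forall>p\<in>A. \<not> p dvd n)}. of_nat n powr (-s))"
  using assms(2,3)
proof (induction A rule: finite_induct)
  case empty
  show ?case unfolding zeta_def prod.empty mult_1_right
    by (rule infsum_cong_neutral) auto
next
  case (insert q A)
  let ?f = "\<lambda>n::nat. of_nat n powr (-s) :: complex"
  let ?S = "\<lambda>A. {n::nat. n > 0 \<and> (\<forall>p\<in>A. \<not> p dvd n)}"
  let ?M = "{n \<in> ?S A. q dvd n}"
  have q: "prime q" and A: "\<And>p. p \<in> A \<Longrightarrow> prime p" using insert by auto
  have bij: "bij_betw (\<lambda>m. q * m) (?S A) ?M"
  proof (rule bij_betwI[of _ _ _ "\<lambda>n. n div q"])
    have "\<not> p dvd q * m" if "p \<in> A" "\<not> p dvd m" for p m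
      using that A[of p] q insert.hyps(2) primes_dvd_imp_eq[of p q] by (auto simp: prime_dvd_mult_iff)
    then show "(\<lambda>m. q * m) \<in> ?S A \<rightarrow> ?M" using q by (auto simp: prime_gt_0_nat)
    show "(\<lambda>n. n div q) \<in> ?M \<rightarrow> ?S A" by (auto elim!: dvdE)
  qed (use q in \<open>auto simp: prime_gt_0_nat\<close>)
  have "infsum ?f ?M = infsum (\<lambda>m. ?f (q * m)) (?S A)"
    using infsum_reindex_bij_betw[OF bij, of ?f] by simp
  also have "\<dots> = infsum (\<lambda>m. ?f q * ?f m) (?S A)"
    by (intro infsum_cong) (simp add: powr_times_real)
  also have "\<dots> = ?f q * infsum ?f (?S A)"
    by (rule infsum_cmult_right) (rule nat_powr_summable_on[OF assms(1)])
  finally have M: "infsum ?f ?M = ?f q * infsum ?f (?S A)" .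
  have "infsum ?f (?S A) = infsum ?f (?S (insert q A) \<union> ?M)"
    by (rule arg_cong[of _ _ "infsum ?f"]) auto
  also have "\<dots> = infsum ?f (?S (insert q A)) + infsum ?f ?M"
    by (rule infsum_Un_disjoint) (auto intro: nat_powr_summable_on[OF assms(1)])
  finally have "infsum ?f (?S (insert q A)) = infsum ?f (?S A) - ?f q * infsum ?f (?S A)"
    unfolding M by (rule add_implies_diff[OF sym])
  also have "\<dots> = infsum ?f (?S A) * (1 - ?f q)" by (simp only: algebra_simps mult_1_left)
  also have "infsum ?f (?S A) = zeta s * (\<Prod>p\<in>A. 1 - ?f p)"
    using insert.IH[OF A] by simp
  finally show ?case using insert.hyps by (simp add: mult_ac)
qed

lemma norm_Ln_one_minus_le:
  fixes z :: complex
  assumes "norm z \<le> 1/2"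
  shows "norm (- Ln (1 - z) - z) \<le> 2 * norm z ^ 2" "norm (- Ln (1 - z)) \<le> 2 * norm z"
proof -
  have "- Ln (1 - z) - z = - (Ln (1 + - z) - (- z))" by simp
  then have "norm (- Ln (1 - z) - z) = norm (Ln (1 + - z) - (- z))"
    by (simp only: norm_minus_cancel)
  also have "\<dots> \<le> norm (-z) ^ 2 / (1 - norm (-z))"
    by (rule Ln_approx_linear) (use assms in auto)
  also have "\<dots> \<le> norm z ^ 2 / (1/2)"
    using assms unfolding norm_minus_cancel by (intro divide_left_mono) auto
  finally show *: "norm (- Ln (1 - z) - z) \<le> 2 * norm z ^ 2" by simp
  have "norm (- Ln (1 - z)) \<le> norm (- Ln (1 - z) - z) + norm z"
    by (metis diff_add_cancel norm_triangle_ineq)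
  also have "2 * norm z ^ 2 \<le> norm z" 
    using mult_right_mono[OF assms, of "norm z"] by (simp add: power2_eq_square)
  with * have "norm (- Ln (1 - z) - z) \<le> norm z" by linarith
  finally show "norm (- Ln (1 - z)) \<le> 2 * norm z" by simp
qed

lemma prime_powr_le_half:
  assumes "prime p" "\<sigma> \<ge> 1"
  shows "real p powr (-\<sigma>) \<le> 1/2"
proof -
  have "real p \<ge> 2" using prime_ge_2_nat[OF assms(1)] by simp
  have "real p powr (-\<sigma>) \<le> real p powr (-1)"
    using assms \<open>real p \<ge> 2\<close> by (intro powr_mono) auto
  also have "\<dots> \<le> 1/2" using \<open>real p \<ge> 2\<close> by (simp add: powr_minus field_simps)
  finally show ?thesis .
qed

lemma log_zeta_summand_summable_on:
  assumes "Re s > 1"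
  shows "(\<lambda>p. - Ln (1 - of_nat p powr (-s))) summable_on {p::nat. prime p}"
proof (rule abs_summable_summable)
  have "(\<lambda>p. 2 * real p powr (-Re s)) summable_on {p. prime p}"
    by (intro summable_on_cmult_right real_powr_summable_on assms)
  then show "(\<lambda>p. norm (- Ln (1 - of_nat p powr (-s)))) summable_on {p::nat. prime p}"
  proof (rule summable_on_comparison_test)
    fix p :: nat assume "p \<in> {p. prime p}"
    then show "norm (- Ln (1 - of_nat p powr (-s))) \<le> 2 * real p powr (-Re s)"
      using norm_Ln_one_minus_le(2)[of "of_nat p powr (-s)"] prime_powr_le_half[of p "Re s"] assms
      by (simp add: norm_nat_powr)
  qed auto
qed

text \<open>After sieving by all primes up to \<open>N\<close>, only \<open>n = 1\<close> and some \<open>n > N\<close> are left, so the sieved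
  series tends to 1. This is the Euler product.\<close>
lemma exp_log_zeta:
  assumes "Re s > 1"
  shows "exp (log_zeta s) = zeta s"
proof -
  let ?f = "\<lambda>n::nat. of_nat n powr (-s) :: complex"
  let ?A = "\<lambda>N. {p::nat. prime p \<and> p \<le> N}"
  let ?S = "\<lambda>N. {n::nat. n > 0 \<and> (\<forall>p\<in>?A N. \<not> p dvd n)}"
  define L where "L = (\<lambda>p. - Ln (1 - ?f p))"
  have fin: "finite (?A N)" for N by simp
  have one: "1 - ?f p \<noteq> 0" if "prime p" for p
  proof
    assume "1 - ?f p = 0"
    then have "norm (?f p) = 1" by (metis eq_iff_diff_eq_0 norm_one)
    with prime_powr_le_half[OF that, of "Re s"] assms show False by (simp add: norm_nat_powr)
  qed
  have prod: "zeta s * exp (- (\<Sum>p\<in>?A N. L p)) = infsum ?f (?S N)" for N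
  proof -
    have "exp (- (\<Sum>p\<in>?A N. L p)) = (\<Prod>p\<in>?A N. exp (- L p))"
      by (simp add: exp_sum[OF fin, symmetric] sum_negf)
    also have "\<dots> = (\<Prod>p\<in>?A N. 1 - ?f p)"
      unfolding L_def minus_minus by (intro prod.cong refl exp_Ln one) auto
    finally show ?thesis using euler_sieve[OF assms fin, of N] by simp
  qed
  have lim1: "(\<lambda>N. infsum ?f (?S N)) \<longlonglongrightarrow> 1"
  proof (rule LIM_zero_cancel, rule Lim_null_comparison)
    let ?g = "\<lambda>n. real n powr (-Re s)"
    have g: "?g summable_on X" for X by (rule real_powr_summable_on[OF assms])
    have "norm (infsum ?f (?S N) - 1) \<le> infsum ?g {n. n > N}" if "N \<ge> 1" for N
    proof -
      have sub: "?S N - {1} \<subseteq> {n. n > N}"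
      proof
        fix n assume n: "n \<in> ?S N - {1}"
        then obtain p where p: "prime p" "p dvd n" using prime_factor_nat[of n] by auto
        then have "\<not> p \<le> N" using n by auto
        moreover have "p \<le> n" using p n by (auto intro: dvd_imp_le)
        ultimately show "n \<in> {n. n > N}" by auto
      qed
      have 1: "1 \<in> ?S N" by auto
      have "infsum ?f (?S N) = infsum ?f ({1} \<union> (?S N - {1}))"
        by (rule arg_cong[of _ _ "infsum ?f"]) (use 1 in auto)
      also have "\<dots> = infsum ?f {1} + infsum ?f (?S N - {1})"
        by (rule infsum_Un_disjoint) (auto intro: nat_powr_summable_on[OF assms])
      finally have "infsum ?f (?S N) - 1 = infsum ?f (?S N - {1})" by simp
      also have "norm \<dots> \<le> infsum (\<lambda>n. norm (?f n)) (?S N - {1})"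
        by (rule norm_infsum_bound) (rule nat_powr_abs_summable_on[OF assms])
      also have "\<dots> \<le> infsum ?g {n. n > N}"
        unfolding norm_nat_powr uminus_complex.simps
        by (rule infsum_mono_neutral) (use sub g in auto)
      finally show ?thesis .
    qed
    then show "\<forall>\<^sub>F N in sequentially. norm (infsum ?f (?S N) - 1) \<le> infsum ?g {n. n > N}"
      by (intro eventually_sequentiallyI[of 1]) auto
    have "(\<lambda>N. infsum ?g UNIV - (\<Sum>n\<le>N. ?g n)) \<longlonglongrightarrow> infsum ?g UNIV - infsum ?g UNIV"
    proof (intro tendsto_diff tendsto_const)
      have "?g sums infsum ?g UNIV"
        by (rule has_sum_imp_sums) (rule has_sum_infsum[OF g])
      then show "(\<lambda>N. \<Sum>n\<le>N. ?g n) \<longlonglongrightarrow> infsum ?g UNIV" by (simp add: sums_def_le)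
    qed
    moreover have "infsum ?g UNIV - (\<Sum>n\<le>N. ?g n) = infsum ?g {n. n > N}" for N
    proof -
      have "infsum ?g UNIV = infsum ?g ({..N} \<union> {n. n > N})"
        by (rule arg_cong[of _ _ "infsum ?g"]) auto
      also have "\<dots> = infsum ?g {..N} + infsum ?g {n. n > N}"
        by (rule infsum_Un_disjoint) (auto intro: g)
      finally show ?thesis by simp
    qed
    ultimately show "(\<lambda>N. infsum ?g {n. n > N}) \<longlonglongrightarrow> 0" by simp
  qed
  have lim2: "(\<lambda>N. \<Sum>p\<in>?A N. L p) \<longlonglongrightarrow> log_zeta s"
  proof -
    have "(L has_sum log_zeta s) {p. prime p}"
      unfolding log_zeta_def L_def by (rule has_sum_infsum[OF log_zeta_summand_summable_on[OF assms]])
    moreover have "filterlim ?A (finite_subsets_at_top {p. prime p}) sequentially"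
      unfolding filterlim_finite_subsets_at_top
    proof (intro allI impI)
      fix X :: "nat set" assume X: "finite X \<and> X \<subseteq> {p. prime p}"
      show "\<forall>\<^sub>F N in sequentially. finite (?A N) \<and> X \<subseteq> ?A N \<and> ?A N \<subseteq> {p. prime p}"
        by (rule eventually_sequentiallyI[of "Max (insert 0 X)"]) (use X in \<open>auto simp: subset_iff\<close>)
    qed
    ultimately show ?thesis unfolding has_sum_def by (rule filterlim_compose)
  qed
  have "(\<lambda>N. zeta s * exp (- (\<Sum>p\<in>?A N. L p))) \<longlonglongrightarrow> zeta s * exp (- log_zeta s)"
    by (intro tendsto_intros lim2)
  with lim1 have "zeta s * exp (- log_zeta s) = 1"
    unfolding prod using LIMSEQ_unique by blast
  then show ?thesis by (simp add: exp_minus field_simps)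
qed

lemma log_zeta_holomorphic: "log_zeta holomorphic_on {s. Re s > 1}"
  unfolding log_zeta_def[abs_def]
proof (rule holomorphic_on_infsum)
  show "open {s. Re s > 1}" by (rule open_halfspace_Re_gt)
  fix p :: nat assume p: "p \<in> {p. prime p}"
  have "1 - of_nat p powr (-s) \<notin> \<real>\<^sub>\<le>\<^sub>0" if "Re s > 1" for s
  proof -
    have "norm (of_nat p powr (-s)) \<le> 1/2" 
      using prime_powr_le_half[of p "Re s"] p that by (simp add: norm_nat_powr)
    then have "Re (of_nat p powr (-s)) \<le> 1/2" using complex_Re_le_cmod order_trans by blast
    then show ?thesis by (auto simp: complex_nonpos_Reals_iff)
  qed
  then show "(\<lambda>s. - Ln (1 - of_nat p powr (-s))) holomorphic_on {s. Re s > 1}"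
    using p by (intro holomorphic_intros) auto
next
  fix z assume z: "z \<in> {s. Re s > 1}"
  define r where "r = (Re z - 1) / 2"
  have r: "r > 0" using z by (simp add: r_def)
  have y: "Re y \<ge> 1 + r" if "y \<in> cball z r" for y
    using abs_Re_le_cmod[of "z - y"] that by (simp add: dist_norm r_def field_simps)
  have "norm (- Ln (1 - of_nat p powr (-y))) \<le> 2 * real p powr (-(1 + r))"
    if "prime p" "y \<in> cball z r" for p :: nat and y
  proof -
    have "Re y \<ge> 1" using y[OF that(2)] r by simp
    then have "norm (- Ln (1 - of_nat p powr (-y))) \<le> 2 * real p powr (-Re y)"
      using norm_Ln_one_minus_le(2)[of "of_nat p powr (-y)"] prime_powr_le_half[OF that(1), of "Re y"]
      by (simp add: norm_nat_powr)
    also have "real p powr (-Re y) \<le> real p powr (-(1 + r))"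
      using y[OF that(2)] prime_ge_1_nat[OF that(1)] by (intro powr_mono) auto
    finally show ?thesis by simp
  qed
  moreover have "(\<lambda>p. 2 * real p powr (-(1 + r))) summable_on {p. prime p}"
    by (intro summable_on_cmult_right real_powr_summable_on) (use r in auto)
  ultimately show "\<exists>r>0. cball z r \<subseteq> {s. Re s > 1} \<and>
      (\<exists>M. M summable_on {p. prime p} \<and> 
        (\<forall>p\<in>{p::nat. prime p}. \<forall>y\<in>cball z r. norm (- Ln (1 - of_nat p powr (-y))) \<le> M p))"
    using r by (intro exI[of _ r] conjI exI[of _ "\<lambda>p. 2 * real p powr (-(1 + r))"])
       (auto dest!: y)
qed

text \<open>The terms of second and higher order in \<open>- Ln (1 - z)\<close> contribute at most
  \<open>\<Sum> 2 * p powr (-2)\<close>, uniformly up to the line \<open>Re s = 1\<close>.\<close>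
lemma log_zeta_prime_zeta_bound:
  "\<exists>C. \<forall>s. Re s > 1 \<longrightarrow> norm (log_zeta s - prime_zeta s) \<le> C"
proof (intro exI allI impI)
  fix s :: complex assume s: "Re s > 1"
  let ?P = "{p::nat. prime p}"
  have b: "norm (- Ln (1 - of_nat p powr (-s)) - of_nat p powr (-s)) \<le> 2 * real p powr (-2)"
    if "p \<in> ?P" for p
  proof -
    have p: "p \<ge> 1" "prime p" using that prime_ge_1_nat by auto
    have "norm (- Ln (1 - of_nat p powr (-s)) - of_nat p powr (-s)) \<le> 2 * (real p powr (-Re s))^2"
      using norm_Ln_one_minus_le(1)[of "of_nat p powr (-s)"] prime_powr_le_half[of p "Re s"] p s
      by (simp add: norm_nat_powr)
    also have "(real p powr (-Re s))^2 = real p powr (-2 * Re s)"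
      using p by (simp add: powr_power)
    also have "\<dots> \<le> real p powr (-2)" using p s by (intro powr_mono) auto
    finally show ?thesis by simp
  qed
  have sm: "(\<lambda>p. 2 * real p powr (-2)) summable_on ?P"
    by (intro summable_on_cmult_right real_powr_summable_on) auto
  have abs: "(\<lambda>p. norm (- Ln (1 - of_nat p powr (-s)) - of_nat p powr (-s))) summable_on ?P"
    using sm by (rule summable_on_comparison_test) (use b in auto)
  have "log_zeta s = (\<Sum>\<^sub>\<infinity>p\<in>?P. of_nat p powr (-s) +
      (- Ln (1 - of_nat p powr (-s)) - of_nat p powr (-s)))"
    unfolding log_zeta_def by (rule infsum_cong) simp
  also have "\<dots> = prime_zeta s +
      (\<Sum>\<^sub>\<infinity>p\<in>?P. - Ln (1 - of_nat p powr (-s)) - of_nat p powr (-s))"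
    unfolding prime_zeta_def
    by (rule infsum_add[OF nat_powr_summable_on[OF s] abs_summable_summable[OF abs]])
  finally have "log_zeta s - prime_zeta s =
      (\<Sum>\<^sub>\<infinity>p\<in>?P. - Ln (1 - of_nat p powr (-s)) - of_nat p powr (-s))"
    by simp
  also have "norm \<dots> \<le> (\<Sum>\<^sub>\<infinity>p\<in>?P. 
      norm (- Ln (1 - of_nat p powr (-s)) - of_nat p powr (-s)))"
    by (rule norm_infsum_bound[OF abs])
  also have "\<dots> \<le> (\<Sum>\<^sub>\<infinity>p\<in>?P. 2 * real p powr (-2))"
    by (rule infsum_mono[OF abs sm b])
  finally show "norm (log_zeta s - prime_zeta s) \<le> (\<Sum>\<^sub>\<infinity>p\<in>?P. 2 * real p powr (-2))" .
qed


section \<open>Continuation and non-vanishing on the line of real part one\<close>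

text \<open>For \<open>n > 0\<close> this is \<open>s - 1\<close> times the difference between the term \<open>n powr (-s)\<close> and the integral of
  \<open>x powr (-s)\<close> over \<open>[n, n + 1]\<close>, multiplied out so that it is entire and \<open>s = 1\<close> needs no special
  treatment. For \<open>n = 0\<close> it is the constant 1, which is the contribution of the pole at 1.\<close>
definition zeta_step :: "nat \<Rightarrow> complex \<Rightarrow> complex" where
  "zeta_step n s = (s - 1) * of_nat n powr (-s) - of_nat n powr (1 - s) + of_nat (Suc n) powr (1 - s)"

text \<open>The continuation of \<open>(s - 1) * zeta s\<close> to \<open>Re s > 0\<close>.\<close>
definition reg_zeta :: "complex \<Rightarrow> complex" where
  "reg_zeta s = (\<Sum>\<^sub>\<infinity>n. zeta_step n s)"

text \<open>The step is the increment over \<open>[n, n + 1]\<close> of a function with derivative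
  \<open>(s - 1) * (n powr (-s) - w powr (-s))\<close>, and a second application of the mean value inequality
  bounds this difference. The gain of one power of \<open>n\<close> moves convergence from \<open>Re s > 1\<close> to
  \<open>Re s > 0\<close>.\<close>
lemma norm_zeta_step_le:
  assumes n: "n > 0" and s: "Re s > 0"
  shows "norm (zeta_step n s) \<le> norm (s - 1) * norm s * real n powr (- (1 + Re s))"
proof -
  define S where "S = closed_segment (of_nat n) (of_nat (Suc n) :: complex)"
  have S: "z \<in> \<real> \<and> real n \<le> Re z \<and> Re z \<le> real n + 1" if "z \<in> S" for z
    using that closed_segment_of_real[of "real n" "real (Suc n)", where 'a = complex]
    by (auto simp: S_def closed_segment_eq_real_ivl)
  have convex: "convex S" by (simp add: S_def)
  have mem: "of_nat n \<in> S" "of_nat (Suc n) \<in> S" by (auto simp: S_def)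
  have npos: "z \<notin> \<real>\<^sub>\<le>\<^sub>0" if "z \<in> S" for z
    using S[OF that] n by (auto simp: complex_nonpos_Reals_iff)
  let ?B = "norm s * real n powr (- (1 + Re s))"
  have inner: "norm (of_nat n powr (-s) - z powr (-s)) \<le> ?B" if z: "z \<in> S" for z
  proof -
    have "norm (of_nat n powr (-s) - z powr (-s)) \<le> ?B * norm (of_nat n - z)"
    proof (rule field_differentiable_bound[OF convex _ _ mem(1) z])
      fix w assume w: "w \<in> S"
      show "((\<lambda>w. w powr (-s)) has_field_derivative (- s) * w powr (- s - 1)) (at w within S)"
        using npos[OF w] by (auto intro!: derivative_eq_intros has_field_derivative_powr)
      have "norm (w powr (-s-1)) = Re w powr (- (1 + Re s))"
        using S[OF w] n by (subst norm_powr_real_powr) (auto intro: arg_cong[of _ _ "(powr) _"])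
      also have "\<dots> \<le> real n powr (- (1 + Re s))"
        using S[OF w] n s by (intro powr_mono2') auto
      finally show "norm ((- s) * w powr (- s - 1)) \<le> ?B"
        by (simp add: norm_mult mult_left_mono)
    qed
    also have "of_nat n - z = of_real (real n - Re z)"
      using S[OF z] by (simp add: complex_eq_iff complex_is_Real_iff)
    also have "norm \<dots> = \<bar>real n - Re z\<bar>" by (rule norm_of_real)
    also have "?B * \<dots> \<le> ?B * 1"
      using S[OF z] by (intro mult_left_mono) auto
    finally show ?thesis by simp
  qed
  let ?F = "\<lambda>w. (s - 1) * of_nat n powr (-s) * w + w powr (1 - s)"
  have "norm (?F (of_nat (Suc n)) - ?F (of_nat n)) \<le>
      (norm (s - 1) * ?B) * norm (of_nat (Suc n) - of_nat n :: complex)"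
  proof (rule field_differentiable_bound[OF convex _ _ mem(2,1)])
    fix w assume w: "w \<in> S"
    show "(?F has_field_derivative (s - 1) * (of_nat n powr (-s) - w powr (-s))) (at w within S)"
      using npos[OF w]
      by (auto intro!: derivative_eq_intros has_field_derivative_powr simp: algebra_simps)
    show "norm ((s - 1) * (of_nat n powr (-s) - w powr (-s))) \<le> norm (s - 1) * ?B"
      using inner[OF w] by (simp add: norm_mult mult_left_mono)
  qed
  also have "?F (of_nat (Suc n)) - ?F (of_nat n) = zeta_step n s"
    by (simp add: zeta_step_def algebra_simps)
  finally show ?thesis by (simp add: mult_ac)
qed

lemma zeta_step_0: "zeta_step 0 s = 1"
  by (simp add: zeta_step_def)

lemma zeta_step_bound:
  assumes s: "0 < r" "r \<le> Re s" and K: "norm (s - 1) * norm s \<le> K"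
  shows "norm (zeta_step n s) \<le> (if n \<in> {0} then 1 else 0) + K * real n powr (- (1 + r))"
proof (cases "n = 0")
  case False
  have "norm (zeta_step n s) \<le> norm (s - 1) * norm s * real n powr (- (1 + Re s))"
    using False s by (intro norm_zeta_step_le) auto
  also have "\<dots> \<le> K * real n powr (- (1 + r))"
    using False s K order_trans[OF mult_nonneg_nonneg[OF norm_ge_zero norm_ge_zero] K]
    by (intro mult_mono powr_mono) auto
  finally show ?thesis using False by simp
qed (simp add: zeta_step_0)

lemma zeta_step_bound_summable:
  assumes "0 < r"
  shows "(\<lambda>n. (if n \<in> {0} then 1 else 0) + K * real n powr (- (1 + r))) summable_on UNIV"
  by (intro summable_on_add summable_on_cmult_right real_powr_summable_on)
     (use assms in \<open>auto intro!: has_sum_imp_summable[OF has_sum_finite_neutralI[of "{0}"]] split: if_splits\<close>)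

lemma reg_zeta_holomorphic: "reg_zeta holomorphic_on {s. Re s > 0}"
  unfolding reg_zeta_def[abs_def]
proof (rule holomorphic_on_infsum)
  show "open {s. Re s > 0}" by (rule open_halfspace_Re_gt)
  show "zeta_step n holomorphic_on {s. 0 < Re s}" for n
    unfolding zeta_step_def[abs_def]
    by (cases "n = 0") (auto intro!: holomorphic_intros simp del: of_nat_Suc)
next
  fix z assume z: "z \<in> {s. Re s > 0}"
  define r where "r = Re z / 2"
  define K where "K = (norm z + r + 1) * (norm z + r)"
  have r: "r > 0" using z by (simp add: r_def)
  have y: "Re y \<ge> r" "norm (y - 1) * norm y \<le> K" if "y \<in> cball z r" for y
  proof -
    show "Re y \<ge> r"
      using abs_Re_le_cmod[of "z - y"] that by (simp add: dist_norm r_def field_simps)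
    have 1: "norm y \<le> norm z + r"
      using that norm_triangle_sub[of y z] by (simp add: dist_norm norm_minus_commute)
    have "norm (y - 1) \<le> norm z + r + 1"
      using norm_triangle_ineq4[of y 1] 1 by simp
    with 1 show "norm (y - 1) * norm y \<le> K"
      unfolding K_def using r by (intro mult_mono) auto
  qed
  have "cball z r \<subseteq> {s. Re s > 0}" using y(1) r by force
  then show "\<exists>r>0. cball z r \<subseteq> {s. Re s > 0} \<and>
      (\<exists>M. M summable_on UNIV \<and> (\<forall>n\<in>UNIV. \<forall>y\<in>cball z r. norm (zeta_step n y) \<le> M n))"
    using r zeta_step_bound_summable[OF r, of K] zeta_step_bound[OF r y] by blast
qed

lemma zeta_step_summable:
  assumes "Re s > 0"
  shows "(\<lambda>n. zeta_step n s) summable_on UNIV"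
proof (rule abs_summable_summable, rule summable_on_comparison_test)
  show "(\<lambda>n. (if n \<in> {0} then 1 else 0) + 
      (norm (s - 1) * norm s) * real n powr (- (1 + Re s))) summable_on UNIV"
    by (rule zeta_step_bound_summable[OF assms])
  show "norm (zeta_step n s) \<le> (if n \<in> {0} then 1 else 0) + 
      (norm (s - 1) * norm s) * real n powr (- (1 + Re s))" for n
    by (rule zeta_step_bound[OF assms]) auto
qed auto

text \<open>The integral parts telescope to \<open>0\<close>: the sum starts at \<open>n = 0\<close> with \<open>0 powr (1 - s) = 0\<close>, and
  \<open>n powr (1 - s)\<close> tends to \<open>0\<close>.\<close>
lemma reg_zeta_eq:
  assumes s: "Re s > 1"
  shows "reg_zeta s = (s - 1) * zeta s"
proof -
  let ?g = "\<lambda>n::nat. of_nat n powr (1 - s) :: complex"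
  have "((\<lambda>n. zeta_step n s) has_sum reg_zeta s) UNIV"
    unfolding reg_zeta_def using s by (intro has_sum_infsum zeta_step_summable) auto
  moreover have "((\<lambda>n::nat. (s - 1) * of_nat n powr (-s)) has_sum (s - 1) * zeta s) UNIV"
    unfolding zeta_def by (intro has_sum_cmult_right has_sum_infsum nat_powr_summable_on s)
  ultimately have "(\<lambda>n. zeta_step n s - (s - 1) * of_nat n powr (-s)) sums 
      (reg_zeta s - (s - 1) * zeta s)"
    by (intro sums_diff has_sum_imp_sums)
  also have "(\<lambda>n. zeta_step n s - (s - 1) * of_nat n powr (-s)) = (\<lambda>n. ?g (Suc n) - ?g n)"
    by (rule ext) (simp add: zeta_step_def)
  finally have 1: "(\<lambda>n. ?g (Suc n) - ?g n) sums (reg_zeta s - (s - 1) * zeta s)" .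
  have "?g \<longlonglongrightarrow> 0"
  proof (rule tendsto_norm_zero_cancel)
    have "(\<lambda>n. real n powr (1 - Re s)) \<longlonglongrightarrow> 0"
      using s by (intro tendsto_neg_powr filterlim_real_sequentially) auto
    then show "(\<lambda>n. norm (?g n)) \<longlonglongrightarrow> 0" by (simp add: norm_nat_powr)
  qed
  then have "(\<lambda>n. ?g (Suc n) - ?g n) sums (0 - ?g 0)" by (rule telescope_sums)
  then have "reg_zeta s - (s - 1) * zeta s = 0" using sums_unique2[OF 1] by simp
  then show ?thesis by simp
qed

lemma reg_zeta_1: "reg_zeta 1 = 1"
proof -
  have "((\<lambda>n. zeta_step n 1) has_sum 1) UNIV"
    by (rule has_sum_finite_neutralI[of "{0}"]) (auto simp: zeta_step_def simp del: of_nat_Suc)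
  then show ?thesis unfolding reg_zeta_def by (rule infsumI)
qed

lemma reg_zeta_tendsto:
  assumes "Re z > 0" 
  shows "(reg_zeta \<longlongrightarrow> reg_zeta z) (at z)"
proof -
  have "isCont reg_zeta z"
    using assms reg_zeta_holomorphic holomorphic_on_imp_continuous_on
      continuous_on_eq_continuous_at[OF open_halfspace_Re_gt[of 0]] by auto
  then show ?thesis by (simp add: isCont_def)
qed

lemma filterlim_Complex_at_right:
  "filterlim (\<lambda>\<sigma>. Complex \<sigma> t) (at (Complex 1 t)) (at_right 1)"
  unfolding filterlim_at
proof
  have "((\<lambda>\<sigma>. Complex \<sigma> t) \<longlongrightarrow> Complex 1 t) (at_right 1)"
    by (intro tendsto_Complex tendsto_ident_at tendsto_const)
  moreover have "\<forall>\<^sub>F \<sigma> in at_right 1. \<sigma> > (1::real)"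
    by (auto simp: eventually_at_filter)
  then have "\<forall>\<^sub>F \<sigma> in at_right 1. Complex \<sigma> t \<noteq> Complex 1 t"
    by eventually_elim auto
  ultimately show "\<forall>\<^sub>F \<sigma> in at_right 1. Complex \<sigma> t \<in> UNIV \<and> Complex \<sigma> t \<noteq> Complex 1 t"
    "((\<lambda>\<sigma>. Complex \<sigma> t) \<longlongrightarrow> Complex 1 t) (at_right 1)" by auto
qed

lemma nat_powr_Complex:
  assumes "n > 0"
  shows "of_nat n powr (Complex x y) = of_real (real n powr x) * cis (y * ln (real n))"
  using assms by (simp add: powr_def exp_eq_polar[of "Complex x y * of_real (ln (real n))"])

lemma prime_zeta_has_sum:
  assumes "Re s > 1"
  shows "((\<lambda>p. of_nat p powr (-s)) has_sum prime_zeta s) {p::nat. prime p}"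
  unfolding prime_zeta_def using assms by (intro has_sum_infsum nat_powr_summable_on)

text \<open>Termwise this is \<open>3 + 4 * cos x + cos (2 * x) = 2 * (1 + cos x)^2 \<ge> 0\<close>.\<close>
lemma three_four_one:
  assumes "\<sigma> > 1"
  shows "Re (3 * prime_zeta (Complex \<sigma> 0) + 4 * prime_zeta (Complex \<sigma> t) + 
    prime_zeta (Complex \<sigma> (2 * t))) \<ge> 0"
proof -
  let ?f = "\<lambda>p::nat. 3 * of_nat p powr (- Complex \<sigma> 0) + 4 * of_nat p powr (- Complex \<sigma> t) + 
    of_nat p powr (- Complex \<sigma> (2 * t)) :: complex"
  have hs: "((\<lambda>p. Re (?f p)) has_sum Re (3 * prime_zeta (Complex \<sigma> 0) + 4 * prime_zeta (Complex \<sigma> t) + 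
    prime_zeta (Complex \<sigma> (2 * t)))) {p. prime p}"
    by (intro has_sum_Re has_sum_add has_sum_cmult_right prime_zeta_has_sum) (use assms in auto)
  have "Re (?f p) \<ge> 0" if "prime p" for p
  proof -
    define x where "x = t * ln (real p)"
    have p: "p > 0" using that prime_gt_0_nat by blast
    have c2: "cos (2 * x) = 2 * cos x ^ 2 - 1" by (rule cos_double_cos)
    have "- Complex x y = Complex (-x) (-y)" for x y by (simp add: complex_eq_iff)
    then have "Re (?f p) = real p powr (-\<sigma>) * (3 + 4 * cos x + cos (2 * x))"
      using p by (simp add: x_def nat_powr_Complex algebra_simps)
    also have "\<dots> = real p powr (-\<sigma>) * (2 * (1 + cos x) ^ 2)"
      unfolding c2 by (simp add: power2_eq_square algebra_simps)
    finally show ?thesis by simp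
  qed
  then show ?thesis using has_sum_nonneg[OF hs] by auto
qed

lemma norm_zeta:
  assumes "Re s > 1"
  shows "norm (zeta s) = exp (Re (log_zeta s))"
  by (metis exp_log_zeta[OF assms] norm_exp_eq_Re)

text \<open>If zeta vanished at \<open>1 + \<i> t\<close>, then in
  \<open>zeta(\<sigma>)^3 * zeta(\<sigma> + \<i> t)^4 * zeta(\<sigma> + 2 \<i> t)\<close> a zero of order at least 4 would outweigh the
  pole of order 3, and the product would tend to 0 as \<open>\<sigma>\<close> decreases to 1. The 3-4-1 inequality
  bounds its modulus away from 0.\<close>
lemma reg_zeta_nonzero:
  assumes t: "t \<noteq> 0" and \<sigma>: "\<sigma> \<ge> 1"
  shows "reg_zeta (Complex \<sigma> t) \<noteq> 0"
proof (cases "\<sigma> = 1")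
  case False
  then have "Re (Complex \<sigma> t) > 1" using \<sigma> by simp
  then show ?thesis using reg_zeta_eq exp_log_zeta t
    by (metis complex.sel(2) exp_not_eq_zero mult_eq_0_iff one_complex.sel(2) right_minus_eq)
next
  case True
  have "reg_zeta (Complex 1 t) \<noteq> 0"
  proof
    assume zero: "reg_zeta (Complex 1 t) = 0"
    obtain C where C: "\<And>s. Re s > 1 \<Longrightarrow> norm (log_zeta s - prime_zeta s) \<le> C"
      using log_zeta_prime_zeta_bound by blast
    define D where "D = deriv reg_zeta (Complex 1 t)"
    have "(reg_zeta has_field_derivative D) (at (Complex 1 t))"
      unfolding D_def
      by (rule holomorphic_derivI[OF reg_zeta_holomorphic open_halfspace_Re_gt]) simp
    then have "((\<lambda>z. (reg_zeta z - 0) / (z - Complex 1 t)) \<longlongrightarrow> D) (at (Complex 1 t))"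
      unfolding has_field_derivative_iff zero .
    from filterlim_compose[OF this filterlim_Complex_at_right]
    have D: "((\<lambda>\<sigma>. reg_zeta (Complex \<sigma> t) / (Complex \<sigma> t - Complex 1 t)) \<longlongrightarrow> D) (at_right 1)"
      by simp
    have lim: "((\<lambda>\<sigma>. reg_zeta (Complex \<sigma> u)) \<longlongrightarrow> reg_zeta (Complex 1 u)) (at_right 1)" for u
      using filterlim_compose[OF reg_zeta_tendsto filterlim_Complex_at_right] by simp
    (* G is the product of zeta values, rewritten so that each factor has a finite limit;
       the factor \<sigma> - 1 is what remains of the zero after cancelling the pole. *)
    define G where "G = (\<lambda>\<sigma>. reg_zeta (Complex \<sigma> 0) ^ 3 * 
        (reg_zeta (Complex \<sigma> t) / (Complex \<sigma> t - Complex 1 t)) ^ 4 * of_real (\<sigma> - 1) *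
        reg_zeta (Complex \<sigma> (2 * t)) / ((Complex \<sigma> t - 1) ^ 4 * (Complex \<sigma> (2 * t) - 1)))"
    have nz: "Complex 1 u - 1 \<noteq> 0" if "u \<noteq> 0" for u using that by (simp add: complex_eq_iff)
    have "(G \<longlongrightarrow> reg_zeta (Complex 1 0) ^ 3 * D ^ 4 * of_real (1 - 1) *
        reg_zeta (Complex 1 (2 * t)) / ((Complex 1 t - 1) ^ 4 * (Complex 1 (2 * t) - 1))) (at_right 1)"
      unfolding G_def
      by (intro tendsto_intros tendsto_Complex D lim) (use t nz[of t] nz[of "2 * t"] in auto)
    then have "(G \<longlongrightarrow> 0) (at_right 1)" by simp
    then have "((\<lambda>\<sigma>. norm (G \<sigma>)) \<longlongrightarrow> 0) (at_right 1)" by (rule tendsto_norm_zero)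
    moreover have "norm (G \<sigma>) \<ge> exp (- 8 * C)" if \<sigma>: "\<sigma> > 1" for \<sigma>
    proof -
      have cancel: "(w * x) ^ 3 * (u * y / w) ^ 4 * w * (v * z) / (u ^ 4 * v) = x ^ 3 * y ^ 4 * z"
        if "w \<noteq> 0" "u \<noteq> 0" "v \<noteq> 0" for u v w x y z :: complex
        using that by (simp add: field_simps eval_nat_numeral)
      have eqs: "Complex \<sigma> t - Complex 1 t = of_real (\<sigma> - 1)" "Complex \<sigma> 0 - 1 = of_real (\<sigma> - 1)"
        by (auto simp: complex_eq_iff)
      have "of_real (\<sigma> - 1) \<noteq> (0::complex)" "Complex \<sigma> t - 1 \<noteq> 0" "Complex \<sigma> (2 * t) - 1 \<noteq> 0"
        using \<sigma> t by (auto simp: complex_eq_iff)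
      from cancel[OF this] 
      have "G \<sigma> = zeta (Complex \<sigma> 0) ^ 3 * zeta (Complex \<sigma> t) ^ 4 * zeta (Complex \<sigma> (2 * t))"
        using \<sigma> unfolding G_def eqs by (simp add: reg_zeta_eq eqs del: of_real_diff)
      then have "norm (G \<sigma>) = exp (3 * Re (log_zeta (Complex \<sigma> 0)) + 4 * Re (log_zeta (Complex \<sigma> t))
          + Re (log_zeta (Complex \<sigma> (2 * t))))"
        using \<sigma> by (simp add: norm_mult norm_power norm_zeta exp_add flip: exp_of_nat_mult)
      moreover have "Re (log_zeta s) \<ge> Re (prime_zeta s) - C" if "Re s > 1" for s
        using abs_Re_le_cmod[of "log_zeta s - prime_zeta s"] C[OF that] by simp
      from this[of "Complex \<sigma> 0"] this[of "Complex \<sigma> t"] this[of "Complex \<sigma> (2 * t)"]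
      have "3 * Re (log_zeta (Complex \<sigma> 0)) + 4 * Re (log_zeta (Complex \<sigma> t))
          + Re (log_zeta (Complex \<sigma> (2 * t))) \<ge> - 8 * C"
        using three_four_one[OF \<sigma>, of t] \<sigma> by simp
      ultimately show ?thesis by simp
    qed
    then have "\<forall>\<^sub>F \<sigma> in at_right 1. norm (G \<sigma>) \<ge> exp (- 8 * C)"
      by (auto simp: eventually_at_filter)
    ultimately have "exp (- 8 * C) \<le> 0"
      by (rule tendsto_lowerbound) simp
    then show False by simp
  qed
  then show ?thesis using True by simp
qed

text \<open>The right-hand side is the logarithmic derivative of zeta, but expressed through
  \<^const>\<open>reg_zeta\<close>, so that it stays
  meaningful on the line \<open>Re s = 1\<close> away from 1.\<close>
lemma log_zeta_has_field_derivative: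
  assumes s: "Re s > 1"
  shows "(log_zeta has_field_derivative (deriv reg_zeta s / reg_zeta s - 1 / (s - 1))) (at s)"
proof -
  have L: "(log_zeta has_field_derivative deriv log_zeta s) (at s)"
    by (rule holomorphic_derivI[OF log_zeta_holomorphic open_halfspace_Re_gt]) (use s in auto)
  have "((\<lambda>z. (z - 1) * exp (log_zeta z)) has_field_derivative 
      exp (log_zeta s) + (s - 1) * (exp (log_zeta s) * deriv log_zeta s)) (at s)"
    by (auto intro!: derivative_eq_intros L)
  then have "(reg_zeta has_field_derivative 
      exp (log_zeta s) + (s - 1) * (exp (log_zeta s) * deriv log_zeta s)) (at s)"
    by (rule has_field_derivative_transform_within_open[OF _ open_halfspace_Re_gt[of 1]])
       (use s in \<open>auto simp: reg_zeta_eq exp_log_zeta\<close>)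
  then have "deriv reg_zeta s = exp (log_zeta s) + (s - 1) * (exp (log_zeta s) * deriv log_zeta s)"
    by (rule DERIV_imp_deriv)
  moreover have "reg_zeta s = (s - 1) * exp (log_zeta s)" 
    using s by (simp add: reg_zeta_eq exp_log_zeta)
  moreover have "s - 1 \<noteq> 0" using s by auto
  moreover have "(e + w * (e * d)) / (w * e) - 1 / w = d" if "e \<noteq> 0" "w \<noteq> 0" for d e w :: complex
    using that by (simp add: field_simps)
  ultimately have "deriv reg_zeta s / reg_zeta s - 1 / (s - 1) = deriv log_zeta s"
    by simp
  with L show ?thesis by simp
qed

text \<open>The logarithmic derivative of zeta is continuous on the compact segment from \<open>1 + \<i> t\<close> to
  \<open>2 + \<i> t\<close>, hence bounded there, so \<open>log_zeta\<close> is Lipschitz on the part with \<open>Re s > 1\<close>. Working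
  with the derivative avoids any discussion of branches of the logarithm.\<close>
lemma prime_zeta_bounded:
  assumes t: "t \<noteq> 0"
  shows "\<exists>B. \<forall>\<sigma>\<in>{1<..2}. norm (prime_zeta (Complex \<sigma> t)) \<le> B"
proof -
  obtain C where C: "\<And>s. Re s > 1 \<Longrightarrow> norm (log_zeta s - prime_zeta s) \<le> C"
    using log_zeta_prime_zeta_bound by blast
  let ?f = "\<lambda>s. deriv reg_zeta s / reg_zeta s - 1 / (s - 1)"
  have seg: "closed_segment (Complex x t) (Complex 2 t) = {s. Im s = t \<and> Re s \<in> {x..2}}" if "x \<le> 2" for x
    using that by (auto simp: closed_segment_same_Im closed_segment_eq_real_ivl)
  define S where "S = closed_segment (Complex 1 t) (Complex 2 t)"
  have S: "\<exists>\<sigma>\<ge>1. s = Complex \<sigma> t" if "s \<in> S" for s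
    using that unfolding S_def seg[of 1, simplified] by (intro exI[of _ "Re s"]) (auto simp: complex_eq_iff)
  have sub: "S \<subseteq> {s. Re s > 0}" using S by force
  have "continuous_on S ?f"
  proof (intro continuous_intros)
    show "continuous_on S (deriv reg_zeta)" "continuous_on S reg_zeta"
      using holomorphic_on_imp_continuous_on[OF holomorphic_on_subset[OF _ sub]]
        reg_zeta_holomorphic holomorphic_deriv[OF reg_zeta_holomorphic open_halfspace_Re_gt] by auto
    show "\<forall>s\<in>S. reg_zeta s \<noteq> 0" using S reg_zeta_nonzero[OF t] by blast
    show "\<forall>s\<in>S. s - 1 \<noteq> 0" using S t by (force simp: complex_eq_iff)
  qed
  then have "bounded (?f ` S)"
    unfolding S_def by (intro compact_imp_bounded compact_continuous_image) auto
  then obtain B where B: "\<And>s. s \<in> S \<Longrightarrow> norm (?f s) \<le> B"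
    by (auto simp: bounded_iff)
  have "norm (prime_zeta (Complex \<sigma> t)) \<le> C + (norm (log_zeta (Complex 2 t)) + B)" 
    if \<sigma>: "1 < \<sigma>" "\<sigma> \<le> 2" for \<sigma>
  proof -
    let ?T = "closed_segment (Complex \<sigma> t) (Complex 2 t)"
    have T: "s \<in> S" "Re s > 1" if "s \<in> ?T" for s
      using that \<sigma> unfolding S_def seg[OF \<sigma>(2)] seg[of 1, simplified] by auto
    have B0: "B \<ge> 0" using B[of "Complex 2 t"] norm_ge_zero order_trans unfolding S_def by blast
    have "norm (log_zeta (Complex \<sigma> t) - log_zeta (Complex 2 t)) \<le> B * norm (Complex \<sigma> t - Complex 2 t)"
      by (rule field_differentiable_bound[of ?T _ ?f])
         (use T B in \<open>auto intro!: has_field_derivative_at_within log_zeta_has_field_derivative\<close>)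
    also have "norm (Complex \<sigma> t - Complex 2 t) = 2 - \<sigma>" using \<sigma> by (simp add: cmod_def)
    also have "B * (2 - \<sigma>) \<le> B * 1" using \<sigma> B0 by (intro mult_left_mono) auto
    finally have "norm (log_zeta (Complex \<sigma> t)) \<le> norm (log_zeta (Complex 2 t)) + B"
      using norm_triangle_sub[of "log_zeta (Complex \<sigma> t)" "log_zeta (Complex 2 t)"] by simp
    moreover have "norm (log_zeta (Complex \<sigma> t) - prime_zeta (Complex \<sigma> t)) \<le> C"
      by (rule C) (use \<sigma> in auto)
    ultimately show ?thesis
      using norm_triangle_sub[of "prime_zeta (Complex \<sigma> t)" "log_zeta (Complex \<sigma> t)"]
      by (simp add: norm_minus_commute)
  qed
  then show ?thesis by (intro exI[of _ "C + (norm (log_zeta (Complex 2 t)) + B)"]) auto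
qed

text \<open>This is the pole of zeta at 1: \<open>exp (Re (log_zeta \<sigma>)) = \<bar>reg_zeta \<sigma>\<bar> / (\<sigma> - 1)\<close>, and the
  numerator tends to 1.\<close>
lemma prime_zeta_at_top:
  "filterlim (\<lambda>\<sigma>. Re (prime_zeta (Complex \<sigma> 0))) at_top (at_right 1)"
proof -
  obtain C where C: "\<And>s. Re s > 1 \<Longrightarrow> norm (log_zeta s - prime_zeta s) \<le> C"
    using log_zeta_prime_zeta_bound by blast
  have gt1: "\<forall>\<^sub>F \<sigma> in at_right 1. \<sigma> > (1::real)" by (auto simp: eventually_at_filter)
  have "((\<lambda>\<sigma>. reg_zeta (Complex \<sigma> 0)) \<longlongrightarrow> reg_zeta (Complex 1 0)) (at_right 1)"
    using filterlim_compose[OF reg_zeta_tendsto filterlim_Complex_at_right] by simp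
  then have "((\<lambda>\<sigma>. norm (reg_zeta (Complex \<sigma> 0))) \<longlongrightarrow> 1) (at_right 1)"
    using tendsto_norm by (fastforce simp: reg_zeta_1 Complex_eq)
  moreover have "filterlim (\<lambda>\<sigma>::real. inverse (\<sigma> - 1)) at_top (at_right 1)"
  proof (rule filterlim_compose[OF filterlim_inverse_at_top_right])
    have "((\<lambda>\<sigma>::real. \<sigma> - 1) \<longlongrightarrow> 1 - 1) (at_right 1)" by (intro tendsto_intros)
    then show "filterlim (\<lambda>\<sigma>::real. \<sigma> - 1) (at_right 0) (at_right 1)"
      using gt1 by (auto simp: filterlim_at elim: eventually_mono)
  qed
  ultimately have "filterlim (\<lambda>\<sigma>. norm (reg_zeta (Complex \<sigma> 0)) * inverse (\<sigma> - 1)) at_top (at_right 1)"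
    by (intro filterlim_tendsto_pos_mult_at_top[where c = 1]) auto
  then have "filterlim (\<lambda>\<sigma>. ln (norm (reg_zeta (Complex \<sigma> 0)) * inverse (\<sigma> - 1))) at_top (at_right 1)"
    by (rule filterlim_compose[OF ln_at_top])
  then have "filterlim (\<lambda>\<sigma>. - C + ln (norm (reg_zeta (Complex \<sigma> 0)) * inverse (\<sigma> - 1))) at_top (at_right 1)"
    by (intro filterlim_tendsto_add_at_top[OF tendsto_const])
  moreover have "\<forall>\<^sub>F \<sigma> in at_right 1. - C + ln (norm (reg_zeta (Complex \<sigma> 0)) * inverse (\<sigma> - 1)) 
      \<le> Re (prime_zeta (Complex \<sigma> 0))"
    using gt1
  proof eventually_elim
    case (elim \<sigma>)
    have "Complex \<sigma> 0 - 1 = of_real (\<sigma> - 1)" by (simp add: complex_eq_iff)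
    then have "norm (reg_zeta (Complex \<sigma> 0)) = (\<sigma> - 1) * exp (Re (log_zeta (Complex \<sigma> 0)))"
      using elim by (simp add: reg_zeta_eq norm_mult norm_zeta del: of_real_diff)
    then have "norm (reg_zeta (Complex \<sigma> 0)) * inverse (\<sigma> - 1) = exp (Re (log_zeta (Complex \<sigma> 0)))"
      using elim by (simp add: field_simps)
    moreover have "Re (log_zeta (Complex \<sigma> 0)) - C \<le> Re (prime_zeta (Complex \<sigma> 0))"
      using abs_Re_le_cmod[of "log_zeta (Complex \<sigma> 0) - prime_zeta (Complex \<sigma> 0)"] 
        C[of "Complex \<sigma> 0"] elim by simp
    ultimately show ?case by simp
  qed
  ultimately show ?thesis by (rule filterlim_at_top_mono)
qed


section \<open>Directions of primes\<close>

text \<open>The Fourier expansion of the kernel \<open>(2 + 2 * cos x)^N = (cis (-x) * (1 + cis x)^2)^N\<close>, from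
  the binomial theorem.\<close>
lemma cis_binomial:
  "(\<Sum>j\<le>2*N. of_nat (2*N choose j) * cis ((real j - real N) * x)) = of_real ((2 + 2 * cos x) ^ N)"
proof -
  have "cis ((real j - real N) * x) = cis (- (real N * x)) * cis x ^ j" for j
    by (simp add: Complex.DeMoivre cis_mult algebra_simps)
  then have "(\<Sum>j\<le>2*N. of_nat (2*N choose j) * cis ((real j - real N) * x)) =
      cis (- (real N * x)) * (\<Sum>j\<le>2*N. of_nat (2*N choose j) * cis x ^ j * 1 ^ (2*N - j))"
    unfolding sum_distrib_left
    by (intro sum.cong refl) (simp add: mult_ac)
  also have "\<dots> = cis (- x) ^ N * ((1 + cis x) ^ 2) ^ N"
    unfolding binomial_ring[symmetric] by (simp add: Complex.DeMoivre power_mult add.commute)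
  also have "\<dots> = (cis (- x) * (1 + cis x) ^ 2) ^ N" by (simp add: power_mult_distrib)
  also have "cis (- x) * (1 + cis x) ^ 2 =
      cis (- x) + 2 * (cis (- x) * cis x) + (cis (- x) * cis x) * cis x"
    by (simp add: power2_eq_square algebra_simps)
  also have "\<dots> = of_real (2 + 2 * cos x)"
    by (simp add: cis_mult) (simp add: complex_eq_iff)
  finally show ?thesis by simp
qed

lemma norm_cis_minus_one: "norm (cis x - 1) ^ 2 = 2 - 2 * cos x"
proof -
  have "norm (cis x - 1) ^ 2 = (cos x - 1) ^ 2 + sin x ^ 2" by (simp add: cmod_power2)
  also have "\<dots> = (sin x ^ 2 + cos x ^ 2) + 1 - 2 * cos x"
    by (simp add: power2_eq_square algebra_simps)
  finally show ?thesis by simp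
qed

lemma has_sum_finite_sum:
  fixes f :: "'i \<Rightarrow> 'a \<Rightarrow> 'b :: topological_comm_monoid_add"
  assumes "\<And>j. j \<in> J \<Longrightarrow> (f j has_sum S j) A"
  shows "((\<lambda>x. \<Sum>j\<in>J. f j x) has_sum (\<Sum>j\<in>J. S j)) A"
  using assms by (induction J rule: infinite_finite_induct) (auto intro: has_sum_add)

text \<open>With \<open>x p\<close> the angle from \<open>w\<close> to the direction of \<open>p\<close>, the kernel
  \<open>K p = ((1 + cos (x p)) / 2)^N\<close> is at most 1 everywhere and at most \<open>q^N\<close> outside the arc, whereas
  its constant term \<open>m\<close>, a normalised central binomial coefficient, is at least \<open>1 / (2 * N)\<close>. All
  non-constant frequencies contribute a bounded amount to \<open>\<Sum> p powr (-\<sigma>) * K p\<close>. If the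
  reciprocals summed to \<open>S\<close> over the arc, then \<open>m * P \<le> q^N * P + S + R\<close> with a constant \<open>R\<close> and
  \<open>P = \<Sum> p powr (-\<sigma>)\<close>, which is false as \<open>P\<close> tends to infinity.\<close>
lemma prime_arc_divergence:
  assumes b: "b \<noteq> 0" and w: "norm w = 1" and \<epsilon>: "\<epsilon> > 0"
  shows "\<not> (\<lambda>p. 1 / real p) summable_on {p. prime p \<and> norm (cis (b * ln (real p)) - w) < \<epsilon>}"
proof
  let ?P = "{p::nat. prime p}"
  define A where "A = {p. prime p \<and> norm (cis (b * ln (real p)) - w) < \<epsilon>}"
  assume "(\<lambda>p. 1 / real p) summable_on {p. prime p \<and> norm (cis (b * ln (real p)) - w) < \<epsilon>}"
  then have sumA: "(\<lambda>p. 1 / real p) summable_on A" by (simp only: A_def)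
  define S where "S = (\<Sum>\<^sub>\<infinity>p\<in>A. 1 / real p)"
  have AP: "A \<subseteq> ?P" by (auto simp: A_def)
  have hsA: "((\<lambda>p. if p \<in> A then 1 / real p else 0) has_sum S) ?P"
    using has_sum_infsum[OF sumA] unfolding S_def
    by (rule has_sum_cong_neutral[THEN iffD1, rotated -1]) (use AP in auto)
  obtain \<phi> where \<phi>: "w = cis \<phi>" using w complex_norm_eq_1_exp[of w] by (metis cis_conv_exp)
  (* Outside the arc, (1 + cos x) / 2 = 1 - \<bar>cis x - 1\<bar>^2 / 4 is at most q; the minimum with 1
     keeps q nonnegative for large \<epsilon>. *)
  define q where "q = 1 - min \<epsilon> 1 ^ 2 / 4"
  have q: "0 \<le> q" "q < 1"
  proof -
    have "min \<epsilon> 1 ^ 2 \<le> 1 ^ 2" using \<epsilon> by (intro power_mono) auto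
    then show "0 \<le> q" by (simp add: q_def)
    show "q < 1" using \<epsilon> by (simp add: q_def)
  qed
  have "(\<lambda>n. of_nat n * q ^ n) \<longlonglongrightarrow> 0" using q by (intro powser_times_n_limit_0) auto
  then have "\<forall>\<^sub>F n in sequentially. of_nat n * q ^ n < 1 / 2"
    by (rule order_tendstoD) simp
  then have "\<forall>\<^sub>F n in sequentially. of_nat n * q ^ n < 1 / 2 \<and> n > 0"
    using eventually_gt_at_top eventually_conj by blast
  then obtain N where N: "of_nat N * q ^ N < 1 / 2" "N > 0"
    using eventually_sequentially by auto
  define m where "m = real (2 * N choose N) / 4 ^ N"
  have "q ^ N < 1 / (2 * real N)" using N by (simp add: field_simps)
  also have "\<dots> \<le> m"
    using central_binomial_lower_bound[OF N(2)] N(2) by (simp add: m_def field_simps)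
  finally have mq: "m - q ^ N > 0" by simp
  (* Since p powr (- s \<sigma> j) = p powr (-\<sigma>) * cis ((j - N) * b * ln p), the index j stands for the
     frequency j - N; the phase in c j rotates the peak of the kernel from 1 to w. *)
  define c where "c = (\<lambda>j. of_nat (2 * N choose j) / 4 ^ N * cis (- ((real j - real N) * \<phi>)))"
  define s where "s = (\<lambda>\<sigma> j. Complex \<sigma> ((real N - real j) * b))"
  define x where "x = (\<lambda>p. b * ln (real p) - \<phi>)"
  define K where "K = (\<lambda>p. ((1 + cos (x p)) / 2) ^ N)"
  have K_eq: "(\<Sum>j\<le>2*N. c j * of_nat p powr (- s \<sigma> j)) = of_real (real p powr (-\<sigma>) * K p)" 
    if "prime p" for p \<sigma>
  proof -
    have p: "p > 0" using that prime_gt_0_nat by blast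
    have "c j * of_nat p powr (- s \<sigma> j) = of_real (real p powr (-\<sigma>) / 4 ^ N) * 
        (of_nat (2*N choose j) * cis ((real j - real N) * x p))" for j
    proof -
      have "- s \<sigma> j = Complex (-\<sigma>) ((real j - real N) * b)"
        by (simp add: s_def complex_eq_iff algebra_simps)
      then have "of_nat p powr (- s \<sigma> j) = 
          of_real (real p powr (-\<sigma>)) * cis ((real j - real N) * b * ln (real p))"
        using nat_powr_Complex[OF p] by simp
      moreover have "(real j - real N) * x p = 
          - ((real j - real N) * \<phi>) + (real j - real N) * b * ln (real p)"
        by (simp add: x_def algebra_simps)
      then have "cis ((real j - real N) * x p) = 
          cis (- ((real j - real N) * \<phi>)) * cis ((real j - real N) * b * ln (real p))"
        by (simp only: cis_mult)
      ultimately show ?thesis by (simp add: c_def mult_ac)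
    qed
    then have "(\<Sum>j\<le>2*N. c j * of_nat p powr (- s \<sigma> j)) = of_real (real p powr (-\<sigma>) / 4 ^ N) * 
        of_real ((2 + 2 * cos (x p)) ^ N)"
      by (simp only: sum_distrib_left[symmetric] cis_binomial)
    also have "\<dots> = of_real (real p powr (-\<sigma>) * ((2 + 2 * cos (x p)) / 4) ^ N)"
      by (simp add: power_divide)
    also have "(2 + 2 * cos (x p)) / 4 = (1 + cos (x p)) / 2" by simp
    finally show ?thesis by (simp add: K_def)
  qed
  have K01: "0 \<le> K p" "K p \<le> 1" for p
  proof -
    have "0 \<le> 1 + cos (x p)" using cos_ge_minus_one[of "x p"] by linarith
    moreover have "cos (x p) \<le> 1" by simp
    ultimately show "0 \<le> K p" "K p \<le> 1" unfolding K_def by (auto intro!: power_le_one zero_le_power)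
  qed
  have K_off: "K p \<le> q ^ N" if "prime p" "p \<notin> A" for p
  proof -
    have "cis (b * ln (real p)) - w = cis \<phi> * (cis (x p) - 1)"
      by (simp add: \<phi> x_def right_diff_distrib cis_mult)
    then have "norm (cis (x p) - 1) = norm (cis (b * ln (real p)) - w)" by (simp add: norm_mult)
    also have "\<dots> \<ge> \<epsilon>" using that by (auto simp: A_def)
    finally have "min \<epsilon> 1 ^ 2 \<le> norm (cis (x p) - 1) ^ 2"
      using \<epsilon> by (intro power_mono) auto
    then have "(1 + cos (x p)) / 2 \<le> q"
      unfolding norm_cis_minus_one q_def by simp
    moreover have "0 \<le> 1 + cos (x p)" using cos_ge_minus_one[of "x p"] by linarith
    ultimately show ?thesis unfolding K_def by (intro power_mono) auto
  qed
  have "\<forall>j\<in>{..2*N} - {N}. \<exists>B. \<forall>\<sigma>\<in>{1<..2}. norm (prime_zeta (s \<sigma> j)) \<le> B"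
    unfolding s_def using b by (intro ballI prime_zeta_bounded) auto
  then obtain B where B: "\<And>j \<sigma>. j \<in> {..2*N} - {N} \<Longrightarrow> \<sigma> \<in> {1<..2} \<Longrightarrow> norm (prime_zeta (s \<sigma> j)) \<le> B j"
    by metis
  define R where "R = (\<Sum>j\<in>{..2*N} - {N}. norm (c j) * B j)"
  have le: "(m - q ^ N) * Re (prime_zeta (Complex \<sigma> 0)) \<le> S + R" if \<sigma>: "\<sigma> \<in> {1<..2}" for \<sigma>
  proof -
    have \<sigma>1: "\<sigma> > 1" using \<sigma> by simp
    have hs: "((\<lambda>p. of_nat p powr (- s \<sigma> j)) has_sum prime_zeta (s \<sigma> j)) ?P" for j
      by (rule prime_zeta_has_sum) (use \<sigma> in \<open>simp add: s_def\<close>)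
    have "((\<lambda>p. \<Sum>j\<le>2*N. c j * of_nat p powr (- s \<sigma> j)) has_sum (\<Sum>j\<le>2*N. c j * prime_zeta (s \<sigma> j))) ?P"
      by (intro has_sum_finite_sum has_sum_cmult_right hs)
    then have "((\<lambda>p. of_real (real p powr (-\<sigma>) * K p)) has_sum (\<Sum>j\<le>2*N. c j * prime_zeta (s \<sigma> j))) ?P"
      by (rule has_sum_cong[THEN iffD1, rotated]) (simp add: K_eq)
    then have "((\<lambda>p. Re (of_real (real p powr (-\<sigma>) * K p))) has_sum 
        Re (\<Sum>j\<le>2*N. c j * prime_zeta (s \<sigma> j))) ?P"
      by (rule has_sum_Re)
    then have lhs: "((\<lambda>p. real p powr (-\<sigma>) * K p) has_sum Re (\<Sum>j\<le>2*N. c j * prime_zeta (s \<sigma> j))) ?P"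
      by (simp only: Re_complex_of_real)
    have "((\<lambda>p. Re (of_nat p powr (- Complex \<sigma> 0))) has_sum Re (prime_zeta (Complex \<sigma> 0))) ?P"
      by (intro has_sum_Re prime_zeta_has_sum) (use \<sigma> in auto)
    then have "((\<lambda>p. real p powr (-\<sigma>)) has_sum Re (prime_zeta (Complex \<sigma> 0))) ?P"
    proof (rule has_sum_cong[THEN iffD1, rotated])
      fix p assume "p \<in> ?P"
      then have "p > 0" using prime_gt_0_nat by blast
      moreover have "- Complex \<sigma> 0 = Complex (-\<sigma>) 0" by (simp add: complex_eq_iff)
      ultimately show "Re (of_nat p powr (- Complex \<sigma> 0)) = real p powr (-\<sigma>)"
        by (simp add: nat_powr_Complex)
    qed
    then have rhs: "((\<lambda>p. (if p \<in> A then 1 / real p else 0) + q ^ N * real p powr (-\<sigma>)) has_sum 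
        S + q ^ N * Re (prime_zeta (Complex \<sigma> 0))) ?P"
      by (intro has_sum_add hsA has_sum_cmult_right)
    have "Re (\<Sum>j\<le>2*N. c j * prime_zeta (s \<sigma> j)) \<le> S + q ^ N * Re (prime_zeta (Complex \<sigma> 0))"
    proof (rule has_sum_mono[OF lhs rhs])
      fix p assume "p \<in> ?P"
      then have p: "prime p" "p \<ge> 1" using prime_ge_1_nat by auto
      show "real p powr (-\<sigma>) * K p \<le> (if p \<in> A then 1 / real p else 0) + q ^ N * real p powr (-\<sigma>)"
      proof (cases "p \<in> A")
        case True
        have "real p powr (-\<sigma>) * K p \<le> real p powr (-\<sigma>) * 1"
          by (intro mult_left_mono K01) auto
        also have "\<dots> \<le> real p powr (-1)" unfolding mult_1_right using p \<sigma> by (intro powr_mono) auto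
        also have "\<dots> = 1 / real p" using p by (simp add: powr_minus field_simps)
        finally show ?thesis using True q by (simp add: add_increasing2)
      next
        case False
        then show ?thesis using K_off[OF p(1)] by (simp add: mult.commute mult_right_mono)
      qed
    qed
    moreover have "Re (\<Sum>j\<le>2*N. c j * prime_zeta (s \<sigma> j)) \<ge> m * Re (prime_zeta (Complex \<sigma> 0)) - R"
    proof -
      have cN: "c N = of_real m" "s \<sigma> N = Complex \<sigma> 0" by (simp_all add: c_def m_def s_def)
      have "(\<Sum>j\<le>2*N. c j * prime_zeta (s \<sigma> j)) = 
          of_real m * prime_zeta (Complex \<sigma> 0) + (\<Sum>j\<in>{..2*N} - {N}. c j * prime_zeta (s \<sigma> j))"
        by (subst sum.remove[of _ N]) (auto simp: cN)
      moreover have "norm (\<Sum>j\<in>{..2*N} - {N}. c j * prime_zeta (s \<sigma> j)) \<le> R"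
        unfolding R_def by (intro sum_norm_le) (auto simp: norm_mult intro!: mult_left_mono B[OF _ \<sigma>])
      then have "\<bar>Re (\<Sum>j\<in>{..2*N} - {N}. c j * prime_zeta (s \<sigma> j))\<bar> \<le> R"
        using abs_Re_le_cmod order_trans by blast
      ultimately show ?thesis by simp
    qed
    ultimately show ?thesis by (simp add: algebra_simps)
  qed
  have "\<forall>\<^sub>F \<sigma> in at_right 1. Re (prime_zeta (Complex \<sigma> 0)) > (S + R) / (m - q ^ N)"
    using prime_zeta_at_top by (simp add: filterlim_at_top_dense)
  moreover have "\<forall>\<^sub>F \<sigma>::real in at_right 1. \<sigma> \<in> {1<..2}"
    by (auto simp: eventually_at_right[of 1 2] intro!: exI[of _ 2])
  ultimately have "\<forall>\<^sub>F \<sigma>::real in at_right 1. False"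
  proof eventually_elim
    case (elim \<sigma>)
    then show ?case using le[OF elim(2)] mq by (simp add: field_simps)
  qed
  then show False by simp
qed


section \<open>Multiplicativity\<close>

lemma divisor_sigma_mult_coprime:
  assumes mn: "coprime m n" and pos: "m > 0" "n > 0"
  shows "divisor_sigma c (m * n) = divisor_sigma c m * divisor_sigma c n"
proof -
  let ?D = "\<lambda>n::nat. {d. d dvd n}"
  have bij: "bij_betw (\<lambda>(x, y). x * y) (?D m \<times> ?D n) (?D (m * n))"
  proof (rule bij_betwI[of _ _ _ "\<lambda>d. (gcd d m, gcd d n)"])
    show "(case (gcd d m, gcd d n) of (x, y) \<Rightarrow> x * y) = d" if d: "d \<in> ?D (m * n)" for d
    proof -
      obtain x y where xy: "d = x * y" "x dvd m" "y dvd n" 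
        using d division_decomp[of d m n] by auto
      have "coprime y m" "coprime x n" "coprime m y" "coprime n x"
        using mn xy by (meson coprime_commute coprime_divisors dvd_refl)+
      then show ?thesis using xy
        by (simp add: gcd_mult_left_right_cancel gcd_mult_left_left_cancel gcd_nat.absorb1)
    qed
    show "(gcd (case xy of (x, y) \<Rightarrow> x * y) m, gcd (case xy of (x, y) \<Rightarrow> x * y) n) = xy" 
      if xy': "xy \<in> ?D m \<times> ?D n" for xy
    proof -
      obtain x y where xy: "xy = (x, y)" "x dvd m" "y dvd n" using xy' by auto
      have "coprime y m" "coprime x n" "coprime m y" "coprime n x"
        using mn xy by (meson coprime_commute coprime_divisors dvd_refl)+
      then show ?thesis using xy
        by (simp add: gcd_mult_left_right_cancel gcd_mult_left_left_cancel gcd_nat.absorb1)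
    qed
  qed (auto intro: mult_dvd_mono)
  have "divisor_sigma c (m * n) = (\<Sum>d\<in>?D (m * n). of_nat d powr c)"
    using pos by (simp add: divisor_sigma_powr)
  also have "\<dots> = (\<Sum>(x, y)\<in>?D m \<times> ?D n. of_nat (x * y) powr c)"
    by (subst sum.reindex_bij_betw[OF bij, symmetric]) (simp add: case_prod_unfold)
  also have "\<dots> = (\<Sum>(x, y)\<in>?D m \<times> ?D n. of_nat x powr c * of_nat y powr c)"
    by (intro sum.cong refl) (auto simp: powr_times_real)
  also have "\<dots> = divisor_sigma c m * divisor_sigma c n"
    using pos by (simp add: divisor_sigma_powr sum_product sum.cartesian_product)
  finally show ?thesis .
qed

lemma divisor_sigma_prime_power:
  assumes "prime p"
  shows "divisor_sigma c (p ^ k) = (\<Sum>i\<le>k. (of_nat p powr c) ^ i)"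
proof -
  have p: "p > 1" using assms prime_gt_1_nat by blast
  have D: "{d. d dvd p ^ k} = (\<lambda>i. p ^ i) ` {..k}"
    using divides_primepow_nat[OF assms] by auto
  have inj: "inj_on (\<lambda>i. p ^ i) {..k}" using p by (intro inj_onI) simp
  have pw: "of_nat (p ^ i) powr c = (of_nat p powr c) ^ i" for i
    using p by (induction i) (simp_all add: powr_times_real)
  have "divisor_sigma c (p ^ k) = (\<Sum>i\<le>k. of_nat (p ^ i) powr c)"
    using p by (simp add: divisor_sigma_powr D sum.reindex[OF inj])
  then show ?thesis by (simp only: pw)
qed

lemma divisor_sigma_prod_primes:
  assumes "finite F" "\<And>p. p \<in> F \<Longrightarrow> prime p"
  shows "divisor_sigma c (\<Prod>F) = (\<Prod>p\<in>F. 1 + of_nat p powr c)"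
  using assms
proof (induction F rule: finite_induct)
  case empty
  then show ?case by (simp add: divisor_sigma_def)
next
  case (insert p F)
  have "coprime p (\<Prod>F)"
    using insert by (intro prod_coprime_right) (metis insert_iff primes_coprime)
  moreover have "p > 0" "\<Prod>F > 0" using insert.prems prime_gt_0_nat by (auto intro!: prod_pos)
  moreover have "divisor_sigma c p = 1 + of_nat p powr c"
    using divisor_sigma_prime_power[of p c 1] insert.prems by simp
  ultimately show ?case
    using insert by (simp add: divisor_sigma_mult_coprime)
qed

section \<open>Density for exponents with real part between minus one and zero\<close>

text \<open>The values at squarefree arguments.\<close>
definition prime_products :: "complex \<Rightarrow> complex set" where
  "prime_products c = {\<Prod>p\<in>F. 1 + of_nat p powr c |F. finite F \<and> (\<forall>p\<in>F. prime p)}"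

lemma prime_products_subset: "prime_products c \<subseteq> sigma_range c"
proof
  fix z assume "z \<in> prime_products c"
  then obtain F where F: "finite F" "\<And>p. p \<in> F \<Longrightarrow> prime p" "z = (\<Prod>p\<in>F. 1 + of_nat p powr c)"
    by (auto simp: prime_products_def)
  have "\<Prod>F > 0" using F(2) prime_gt_0_nat by (auto intro!: prod_pos)
  then show "z \<in> sigma_range c"
    using divisor_sigma_prod_primes[OF F(1,2), of c] F(3)
    by (auto simp: sigma_range_def intro!: exI[of _ "\<Prod>F"])
qed

text \<open>Adding the elements one at a time, a step of length at most \<open>\<delta>\<close> cannot jump over the interval
  \<open>[r, r + \<delta>]\<close>.\<close>
lemma subset_sum_between:
  fixes f :: "'a \<Rightarrow> real"
  assumes "finite G" "\<And>x. x \<in> G \<Longrightarrow> f x \<le> \<delta>" "0 \<le> r" "r \<le> sum f G" "0 \<le> \<delta>"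
  shows "\<exists>F\<subseteq>G. r \<le> sum f F \<and> sum f F \<le> r + \<delta>"
  using assms
proof (induction G rule: finite_induct)
  case empty
  then show ?case by auto
next
  case (insert x G)
  show ?case
  proof (cases "r \<le> sum f G")
    case True
    then show ?thesis using insert by (meson insertI2 subset_insertI2)
  next
    case False
    then have "sum f (insert x G) \<le> r + \<delta>"
      using insert.hyps insert.prems(1)[of x] by simp
    then show ?thesis using insert.prems by blast
  qed
qed

text \<open>Let \<open>\<zeta> = Ln z = r * u\<close> with \<open>\<bar>u\<bar> = 1\<close>. For large primes with direction within \<open>\<delta>\<close> of \<open>u\<close> the
  number \<open>Ln (1 + p powr c)\<close> is \<open>p powr a * u\<close> up to an error of \<open>3 * \<delta> * p powr a\<close>. Since the lengths
  \<open>p powr a \<ge> 1 / p\<close> are small and have a divergent sum, finitely many of them sum to between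
  \<open>r\<close> and \<open>r + \<delta>\<close>, and the total error is then proportional to \<open>\<delta>\<close>.\<close>
lemma in_closure_prime_products_if_neg:
  assumes a: "-1 \<le> a" "a < 0" and z: "z \<noteq> 0"
    and b: "b \<noteq> 0"
  shows "z \<in> closure (prime_products (Complex a b))"
  unfolding closure_approachable
proof (intro allI impI)
  fix e :: real assume e: "e > 0"
  define \<zeta> where "\<zeta> = Ln z"
  define r where "r = norm \<zeta>"
  define u where "u = (if \<zeta> = 0 then 1 else sgn \<zeta>)"
  have u: "norm u = 1" "\<zeta> = of_real r * u"
    by (auto simp: u_def r_def norm_sgn) (simp add: sgn_div_norm scaleR_conv_of_real)
  have "isCont exp \<zeta>" by simp
  then obtain \<eta> where \<eta>: "\<eta> > 0" "\<And>y. dist y \<zeta> < \<eta> \<Longrightarrow> dist (exp y) (exp \<zeta>) < e"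
    using e unfolding continuous_at_eps_delta by metis
  (* The total error below is at most 3 * \<delta> * (r + 1) + \<delta>, so this choice keeps it under \<eta>. *)
  define \<delta> where "\<delta> = min (1/2) (\<eta> / (2 * (3 * r + 4)))"
  have r0: "r \<ge> 0" by (simp add: r_def)
  have "\<delta> > 0" using \<eta>(1) r0 by (simp add: \<delta>_def)
  moreover have "\<delta> \<le> 1/2" unfolding \<delta>_def by (rule min.cobounded1)
  ultimately have \<delta>: "\<delta> > 0" "\<delta> \<le> 1/2" by auto
  have "\<delta> * (3 * r + 4) \<le> \<eta> / (2 * (3 * r + 4)) * (3 * r + 4)"
    using r0 by (intro mult_right_mono) (auto simp: \<delta>_def)
  also have "\<dots> = \<eta> / 2" using r0 by (simp add: field_simps)
  finally have \<delta>3: "\<delta> * (3 * r + 4) < \<eta>" using \<eta>(1) by simp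
  let ?A = "{p. prime p \<and> norm (cis (b * ln (real p)) - u) < \<delta>}"
  have "(\<lambda>n. real n powr a) \<longlonglongrightarrow> 0"
    using a by (intro tendsto_neg_powr filterlim_real_sequentially) auto
  then have "\<forall>\<^sub>F n in sequentially. real n powr a < \<delta>"
    using \<delta>(1) by (rule order_tendstoD)
  then obtain M where M: "\<And>n. n \<ge> M \<Longrightarrow> real n powr a < \<delta>"
    by (auto simp: eventually_sequentially)
  define T where "T = ?A \<inter> {M..}"
  have T_not: "\<not> (\<lambda>p. real p powr a) summable_on T"
  proof
    assume "(\<lambda>p. real p powr a) summable_on T"
    then have sT: "(\<lambda>p. 1 / real p) summable_on T"
    proof (rule summable_on_comparison_test)
      fix p assume "p \<in> T"
      then have "prime p" by (simp add: T_def)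
      then have "p \<ge> 1" by (rule prime_ge_1_nat)
      then have "1 / real p = real p powr (-1)" by (simp add: powr_minus field_simps)
      also have "\<dots> \<le> real p powr a" using a \<open>p \<ge> 1\<close> by (intro powr_mono) auto
      finally show "1 / real p \<le> real p powr a" .
    qed simp
    have "(\<lambda>p. 1 / real p) summable_on (?A \<inter> {..<M})" by (rule summable_on_finite) simp
    with sT have "(\<lambda>p. 1 / real p) summable_on (T \<union> (?A \<inter> {..<M}))"
      by (rule summable_on_Un_disjoint) (auto simp: T_def)
    moreover have "T \<union> (?A \<inter> {..<M}) = ?A" by (auto simp: T_def)
    ultimately show False using prime_arc_divergence[OF b u(1) \<delta>(1)] by simp
  qed
  have "\<exists>G. finite G \<and> G \<subseteq> T \<and> r < (\<Sum>p\<in>G. real p powr a)"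
  proof (rule ccontr)
    assume "\<not> ?thesis"
    then have "\<And>G. finite G \<Longrightarrow> G \<subseteq> T \<Longrightarrow> (\<Sum>p\<in>G. real p powr a) \<le> r" by (meson not_le)
    then have "(\<lambda>p. real p powr a) summable_on T"
      by (intro nonneg_bounded_partial_sums_imp_summable_on) 
         (auto simp: eventually_finite_subsets_at_top intro!: exI[of _ "{}"])
    with T_not show False by simp
  qed
  then obtain G where G: "finite G" "G \<subseteq> T" "r < (\<Sum>p\<in>G. real p powr a)" by blast
  have "\<exists>F\<subseteq>G. r \<le> (\<Sum>p\<in>F. real p powr a) \<and> (\<Sum>p\<in>F. real p powr a) \<le> r + \<delta>"
  proof (rule subset_sum_between[OF G(1) _ r0 less_imp_le[OF G(3)] less_imp_le[OF \<delta>(1)]])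
    fix p assume "p \<in> G"
    then have "M \<le> p" using G(2) by (auto simp: T_def)
    then show "real p powr a \<le> \<delta>" using M[of p] by simp
  qed
  then obtain F where F: "F \<subseteq> G" "r \<le> (\<Sum>p\<in>F. real p powr a)" "(\<Sum>p\<in>F. real p powr a) \<le> r + \<delta>"
    by blast
  have finF: "finite F" using F(1) G(1) by (rule finite_subset)
  let ?x = "\<lambda>p::nat. of_nat p powr Complex a b"
  have x: "norm (?x p) < 1/2" "norm (Ln (1 + ?x p) - of_real (real p powr a) * u) \<le> 3 * \<delta> * real p powr a"
    if "p \<in> F" for p
  proof -
    have p: "prime p" "norm (cis (b * ln (real p)) - u) < \<delta>" "real p powr a < \<delta>" 
      using that F(1) G(2) M by (auto simp: T_def)
    then have p0: "p > 0" using prime_gt_0_nat by blast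
    have n: "norm (?x p) = real p powr a" by (simp add: norm_nat_powr)
    then show half: "norm (?x p) < 1/2" using p(3) \<delta>(2) by simp
    have "norm (Ln (1 + ?x p) - ?x p) \<le> norm (?x p) ^ 2 / (1 - norm (?x p))"
      by (rule Ln_approx_linear) (use half in simp)
    also have "\<dots> \<le> norm (?x p) ^ 2 / (1/2)"
      using half by (intro divide_left_mono) auto
    also have "\<dots> \<le> 2 * \<delta> * real p powr a"
      using p(3) unfolding n by (simp add: power2_eq_square mult_right_mono)
    finally have 1: "norm (Ln (1 + ?x p) - ?x p) \<le> 2 * \<delta> * real p powr a" .
    have "?x p - of_real (real p powr a) * u = of_real (real p powr a) * (cis (b * ln (real p)) - u)"
      using p0 by (simp add: nat_powr_Complex algebra_simps)
    then have 2: "norm (?x p - of_real (real p powr a) * u) \<le> \<delta> * real p powr a"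
      using p(2) by (simp add: norm_mult mult.commute[of \<delta>] mult_left_mono)
    show "norm (Ln (1 + ?x p) - of_real (real p powr a) * u) \<le> 3 * \<delta> * real p powr a"
      using norm_triangle_ineq[of "Ln (1 + ?x p) - ?x p" "?x p - of_real (real p powr a) * u"] 1 2
      by simp
  qed
  define s where "s = (\<Sum>p\<in>F. real p powr a)"
  have "norm ((\<Sum>p\<in>F. Ln (1 + ?x p)) - of_real s * u) 
      = norm (\<Sum>p\<in>F. Ln (1 + ?x p) - of_real (real p powr a) * u)"
    by (simp add: s_def sum_subtractf sum_distrib_right)
  also have "\<dots> \<le> (\<Sum>p\<in>F. 3 * \<delta> * real p powr a)"
    by (intro sum_norm_le x(2))
  also have "\<dots> = 3 * \<delta> * s" by (simp add: s_def sum_distrib_left)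
  also have "\<dots> \<le> 3 * \<delta> * (r + 1)"
    using F(3) \<delta> by (intro mult_left_mono) (auto simp: s_def)
  finally have 1: "norm ((\<Sum>p\<in>F. Ln (1 + ?x p)) - of_real s * u) \<le> 3 * \<delta> * (r + 1)" .
  have "of_real s * u - \<zeta> = of_real (s - r) * u" by (simp add: u(2) algebra_simps)
  then have 2: "norm (of_real s * u - \<zeta>) \<le> \<delta>"
    using F(2,3) u(1) by (simp add: norm_mult s_def del: of_real_diff)
  have "norm ((\<Sum>p\<in>F. Ln (1 + ?x p)) - \<zeta>) \<le> 3 * \<delta> * (r + 1) + \<delta>"
    using norm_triangle_ineq[of "(\<Sum>p\<in>F. Ln (1 + ?x p)) - of_real s * u" "of_real s * u - \<zeta>"] 1 2
    by simp
  also have "\<dots> = \<delta> * (3 * r + 4)" by (simp add: algebra_simps)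
  also note \<delta>3
  finally have "dist (exp (\<Sum>p\<in>F. Ln (1 + ?x p))) (exp \<zeta>) < e"
    by (intro \<eta>(2)) (simp add: dist_norm)
  moreover have "exp (\<Sum>p\<in>F. Ln (1 + ?x p)) = (\<Prod>p\<in>F. 1 + ?x p)"
    unfolding exp_sum[OF finF]
  proof (intro prod.cong refl exp_Ln)
    fix p assume "p \<in> F"
    show "1 + ?x p \<noteq> 0"
    proof
      assume "1 + ?x p = 0"
      then have "norm (?x p) = 1" by (metis add_eq_0_iff norm_minus_cancel norm_one)
      with x(1)[OF \<open>p \<in> F\<close>] show False by simp
    qed
  qed
  moreover have "exp \<zeta> = z" using z by (simp add: \<zeta>_def)
  moreover have "(\<Prod>p\<in>F. 1 + ?x p) \<in> prime_products (Complex a b)"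
    using finF F(1) G(2) by (auto simp: prime_products_def T_def)
  ultimately show "\<exists>y\<in>prime_products (Complex a b). dist y z < e" by metis
qed

text \<open>For \<open>a = 0\<close> the factor \<open>1 + w\<close> is approximated by \<open>1 + p powr c\<close> for infinitely many \<open>p\<close>, so
  there is always one that has not yet been used.\<close>
lemma prime_products_closure_mult:
  assumes w: "norm w = 1" and z: "z \<in> closure (prime_products (Complex 0 b))"
    and b: "b \<noteq> 0"
  shows "(1 + w) * z \<in> closure (prime_products (Complex 0 b))"
  unfolding closure_approachable
proof (intro allI impI)
  fix e :: real assume e: "e > 0"
  let ?x = "\<lambda>p::nat. of_nat p powr Complex 0 b"
  obtain F where F: "finite F" "\<forall>p\<in>F. prime p" "dist (\<Prod>p\<in>F. 1 + ?x p) z < e / 4"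
    using z e unfolding closure_approachable prime_products_def
    by (fastforce dest!: spec[of _ "e / 4"])
  define P where "P = (\<Prod>p\<in>F. 1 + ?x p)"
  let ?\<epsilon> = "e / (2 * (norm P + 1))"
  let ?A = "{p. prime p \<and> norm (cis (b * ln (real p)) - w) < ?\<epsilon>}"
  have den: "norm P + 1 > 0" by (simp add: add_nonneg_pos)
  have "?\<epsilon> > 0" using e den by simp
  then have "infinite ?A" using prime_arc_divergence[OF b w] summable_on_finite by blast
  then have "\<not> ?A \<subseteq> F" using F(1) finite_subset by blast
  then obtain p where p: "prime p" "norm (cis (b * ln (real p)) - w) < ?\<epsilon>" "p \<notin> F" by blast
  have xp: "?x p = cis (b * ln (real p))"
    using p(1) prime_gt_0_nat by (simp add: nat_powr_Complex)
  have "(1 + ?x p) * P - (1 + w) * z = (?x p - w) * P + (1 + w) * (P - z)"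
    by (simp add: algebra_simps)
  then have "norm ((1 + ?x p) * P - (1 + w) * z) \<le> norm (?x p - w) * norm P + norm (1 + w) * norm (P - z)"
    by (metis norm_mult norm_triangle_ineq)
  also have "norm (?x p - w) * norm P \<le> ?\<epsilon> * (norm P + 1)"
    unfolding xp by (rule mult_mono[OF less_imp_le[OF p(2)]]) (use \<open>?\<epsilon> > 0\<close> in auto)
  also have "?\<epsilon> * (norm P + 1) = e / 2" using den by (simp add: field_simps)
  also have "norm (1 + w) * norm (P - z) \<le> 2 * norm (P - z)"
    using norm_triangle_ineq[of 1 w] w by (intro mult_right_mono) auto
  also have "\<dots> < e / 2" using F(3) by (simp add: P_def dist_norm)
  finally have "dist ((1 + ?x p) * P) ((1 + w) * z) < e" by (simp add: dist_norm)
  moreover have "(1 + ?x p) * P \<in> prime_products (Complex 0 b)"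
    unfolding prime_products_def mem_Collect_eq P_def
    by (rule exI[of _ "insert p F"]) (use p F in auto)
  ultimately show "\<exists>y\<in>prime_products (Complex 0 b). dist y ((1 + w) * z) < e" by blast
qed

text \<open>Since \<open>1 + cis (2 * y) = 2 * cos y * cis y\<close>, a power \<open>(1 + cis (2 * y))^k\<close> with
  \<open>y = Arg z / k\<close> has the argument of \<open>z\<close>, and for large \<open>k\<close> its modulus \<open>\<rho>\<close> is at least that of \<open>z\<close>. The
  pair \<open>(1 + cis \<psi>) * (1 + cis (-\<psi>)) = 2 + 2 * cos \<psi>\<close> is real and takes every value in \<open>[0, 4]\<close>,
  so it can correct the modulus.\<close>
lemma in_closure_prime_products_if_zero:
  assumes z: "z \<noteq> 0"
    and b: "b \<noteq> 0"
  shows "z \<in> closure (prime_products (Complex 0 b))"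
proof -
  let ?C = "closure (prime_products (Complex 0 b))"
  have mult: "(1 + cis x) * y \<in> ?C" if "y \<in> ?C" for x y
    by (rule prime_products_closure_mult[OF _ that b]) auto
  have one: "1 \<in> ?C"
    by (rule subsetD[OF closure_subset]) (auto simp: prime_products_def intro!: exI[of _ "{}"])
  have pow: "(1 + cis x) ^ k * y \<in> ?C" if "y \<in> ?C" for x k y
    by (induction k) (use that mult in \<open>auto simp: mult.assoc\<close>)
  define r \<phi> where "r = norm z" and "\<phi> = Arg z"
  have z_eq: "z = of_real r * cis \<phi>" using Arg_eq[OF z] by (simp add: r_def \<phi>_def cis_conv_exp)
  have r: "r > 0" using z by (simp add: r_def)
  obtain n where n: "r < sqrt 2 ^ n" using real_arch_pow[of "sqrt 2" r] by auto
  (* k \<ge> 4 gives \<bar>y\<bar> \<le> pi / 4 below, hence 2 * cos y \<ge> sqrt 2 > 1. *)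
  define k where "k = n + 4"
  have "sqrt 2 ^ n \<le> sqrt 2 ^ k" unfolding k_def by (rule power_increasing) auto
  with n have k: "r \<le> sqrt 2 ^ k" "k \<ge> 4" by (linarith, simp add: k_def)
  define y where "y = \<phi> / real k"
  have "\<bar>\<phi>\<bar> \<le> pi" using Arg_bounded[of z] by (auto simp: \<phi>_def)
  then have y: "\<bar>y\<bar> \<le> pi / 4"
    unfolding y_def abs_divide using k(2) by (intro frac_le) auto
  have "cos (pi / 4) \<le> cos \<bar>y\<bar>"
    using y pi_gt_zero by (subst cos_mono_le_eq) auto
  then have cosy: "2 * cos y \<ge> sqrt 2" by (simp add: cos_45)
  define \<rho> where "\<rho> = (2 * cos y) ^ k"
  have "sqrt 2 ^ k \<le> \<rho>" unfolding \<rho>_def using cosy by (intro power_mono) auto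
  then have \<rho>: "r \<le> \<rho>" "\<rho> > 0" using k(1) r by auto
  have "1 + cis (2 * y) = of_real (2 * cos y) * cis y"
    by (simp add: complex_eq_iff cos_double_cos sin_double power2_eq_square)
  then have pw: "(1 + cis (2 * y)) ^ k = of_real \<rho> * cis \<phi>"
    using k(2) by (simp add: power_mult_distrib Complex.DeMoivre \<rho>_def y_def)
  define \<psi> where "\<psi> = arccos (r / (2 * \<rho>) - 1)"
  have "r / (2 * \<rho>) \<ge> 0" "r / (2 * \<rho>) \<le> 1" using r \<rho> by (auto simp: field_simps)
  then have "cos \<psi> = r / (2 * \<rho>) - 1" unfolding \<psi>_def by (intro cos_arccos) auto
  moreover have "(1 + cis \<psi>) * (1 + cis (- \<psi>)) = of_real (2 + 2 * cos \<psi>)"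
    by (simp add: algebra_simps cis_mult) (simp add: complex_eq_iff)
  ultimately have "(1 + cis \<psi>) * (1 + cis (- \<psi>)) = of_real (r / \<rho>)" by simp
  moreover have "(1 + cis \<psi>) * ((1 + cis (- \<psi>)) * ((1 + cis (2 * y)) ^ k * 1)) \<in> ?C"
    by (intro mult pow one)
  ultimately have "of_real (r / \<rho>) * (of_real \<rho> * cis \<phi>) \<in> ?C"
    unfolding pw by (metis mult.assoc mult_1_right)
  then show ?thesis using \<rho> by (simp add: z_eq)
qed

section \<open>Failure of density for the other exponents\<close>

lemma norm_divisor_sigma_le:
  assumes "Re c < -1" "n > 0"
  shows "norm (divisor_sigma c n) \<le> (\<Sum>\<^sub>\<infinity>d. real d powr Re c)"
proof -
  have "norm (divisor_sigma c n) \<le> (\<Sum>d | d dvd n. real d powr Re c)"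
    unfolding divisor_sigma_powr[OF assms(2)]
    by (intro sum_norm_le) (simp add: norm_nat_powr)
  also have "\<dots> \<le> (\<Sum>\<^sub>\<infinity>d. real d powr Re c)"
    using assms real_powr_summable_on[of "- Re c" UNIV] by (intro finite_sum_le_infsum) auto
  finally show ?thesis .
qed

lemma not_dense_if_bounded:
  assumes "bounded S" 
  shows "closure S \<noteq> (UNIV :: complex set)"
proof
  assume "closure S = UNIV"
  then show False using bounded_closure[OF assms] by simp
qed

text \<open>The value is the geometric sum \<open>(z^(k + 1) - 1) / (z - 1)\<close> with \<open>\<bar>z\<bar> = x > 1\<close>; numerator and
  denominator are estimated by the triangle inequality.\<close>
lemma norm_divisor_sigma_prime_power_ge:
  assumes p: "prime p" and k: "k > 0" and a: "Re c > 0"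
  defines "x \<equiv> real p powr Re c"
  shows "norm (divisor_sigma c (p ^ k)) \<ge> x ^ k * ((x - 1) / (x + 1))"
proof -
  let ?z = "of_nat p powr c :: complex"
  have nz: "norm ?z = x" by (simp add: norm_nat_powr x_def)
  have x: "x > 1" unfolding x_def using p a prime_gt_1_nat[of p] by (intro gr_one_powr) auto
  have "(?z - 1) * divisor_sigma c (p ^ k) = ?z ^ Suc k - 1"
    by (simp only: divisor_sigma_prime_power[OF p] power_diff_1_eq lessThan_Suc_atMost)
  then have "norm (?z - 1) * norm (divisor_sigma c (p ^ k)) = norm (?z ^ Suc k - 1)"
    by (metis norm_mult)
  also have "\<dots> \<ge> x ^ Suc k - 1"
    using norm_triangle_ineq2[of "?z ^ Suc k" 1] by (simp add: norm_power nz norm_mult)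
  also have "x ^ Suc k - 1 \<ge> x ^ k * (x - 1)"
    using x one_le_power[of x k] by (simp add: algebra_simps)
  finally have "x ^ k * (x - 1) \<le> norm (?z - 1) * norm (divisor_sigma c (p ^ k))" .
  also have "norm (?z - 1) \<le> x + 1" using norm_triangle_ineq4[of ?z 1] by (simp add: nz)
  finally show ?thesis using x 
    by (simp add: field_simps mult_right_mono)
qed

text \<open>Half of the exponent is given away: \<open>x^k (x - 1) / (x + 1)\<close> with \<open>x = p powr a\<close> is
  \<open>p powr (k * a / 2)\<close> times a quantity that is at least \<open>h p\<close> for every \<open>k > 0\<close>. Since \<open>h p\<close> tends to infinity with \<open>p\<close>,
  only finitely many of the factors \<open>min 1 (h p)\<close> differ from 1.\<close>
lemma norm_divisor_sigma_ge:
  assumes a: "Re c > 0" and n: "n > 0"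
  defines "h \<equiv> \<lambda>p. real p powr (Re c / 2) * ((real p powr Re c - 1) / (real p powr Re c + 1))"
  shows "norm (divisor_sigma c n) \<ge> real n powr (Re c / 2) * (\<Prod>p\<in>prime_factors n. min 1 (h p))"
  using n
proof (induction n rule: less_induct)
  case (less n)
  show ?case
  proof (cases "n = 1")
    case True
    then show ?thesis by (simp add: divisor_sigma_def)
  next
    case False
    then obtain p where p: "prime p" "p dvd n" using prime_factor_nat by blast
    define k where "k = multiplicity p n"
    obtain m where m: "n = p ^ k * m" "\<not> p dvd m"
      using multiplicity_decompose'[of n p] p less.prems unfolding k_def 
      by (metis not_prime_unit less_irrefl)
    have k: "k > 0" using p less.prems unfolding k_def
      by (simp add: prime_multiplicity_gt_zero_iff)
    have m0: "m > 0" using less.prems m(1) by (auto intro: Nat.gr0I)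
    have p1: "p > 1" using p(1) prime_gt_1_nat by blast
    have "m < n" using m(1) m0 k p1 one_less_power[of p k] by simp
    have cop: "coprime (p ^ k) m" using p(1) m(2) by (simp add: prime_imp_coprime)
    define x where "x = real p powr Re c"
    have x: "x > 1" unfolding x_def using p1 a by (intro gr_one_powr) auto
    have sq: "real p powr (Re c / 2) \<ge> 1" using p1 a by (intro ge_one_powr_ge_zero) auto
    have xsq: "x = real p powr (Re c / 2) * real p powr (Re c / 2)"
      unfolding x_def by (simp flip: powr_add)
    define y where "y = real p powr (Re c / 2)"
    have pf: "prime_factors n = insert p (prime_factors m)" "p \<notin> prime_factors m"
    proof -
      have "prime_factors n = prime_factors (p ^ k) \<union> prime_factors m"
        using m(1) m0 p1 by (simp add: prime_factors_product)
      then show "prime_factors n = insert p (prime_factors m)"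
        using k p(1) by (simp add: prime_factorization_prime_power)
      show "p \<notin> prime_factors m" using m(2) by auto
    qed
    have "real n powr (Re c / 2) = y ^ k * real m powr (Re c / 2)"
      unfolding m(1) y_def using p1 m0
      by (simp add: powr_mult powr_powr mult.commute flip: powr_realpow)
    then have "real n powr (Re c / 2) * (\<Prod>p\<in>prime_factors n. min 1 (h p)) =
        (y ^ k * min 1 (h p)) * (real m powr (Re c / 2) * (\<Prod>p\<in>prime_factors m. min 1 (h p)))"
      using pf by simp
    also have "\<dots> \<le> norm (divisor_sigma c (p ^ k)) * norm (divisor_sigma c m)"
    proof (rule mult_mono)
      show "real m powr (Re c / 2) * (\<Prod>p\<in>prime_factors m. min 1 (h p)) \<le> norm (divisor_sigma c m)"
        using less.IH[OF \<open>m < n\<close> m0] .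
      have "y \<le> y ^ k" using k sq power_increasing[of 1 k y] by (simp add: y_def)
      have "y ^ k * min 1 (h p) \<le> y ^ k * h p"
        using sq by (intro mult_left_mono) (auto simp: y_def)
      also have "\<dots> = y ^ k * y * ((x - 1) / (x + 1))" by (simp add: h_def x_def y_def)
      also have "\<dots> \<le> y ^ k * y ^ k * ((x - 1) / (x + 1))"
        using x sq \<open>y \<le> y ^ k\<close> by (intro mult_right_mono mult_left_mono) (auto simp: y_def)
      also have "y ^ k * y ^ k = x ^ k" by (simp add: xsq y_def power_mult_distrib)
      also have "x ^ k * ((x - 1) / (x + 1)) \<le> norm (divisor_sigma c (p ^ k))"
        unfolding x_def by (rule norm_divisor_sigma_prime_power_ge[OF p(1) k a])
      finally show "y ^ k * min 1 (h p) \<le> norm (divisor_sigma c (p ^ k))" .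
      have "0 \<le> min 1 (h q)" if "prime q" for q
      proof -
        have "real q powr Re c \<ge> 1" using prime_ge_1_nat[OF that] a by (intro ge_one_powr_ge_zero) auto
        then show ?thesis by (simp add: h_def)
      qed
      then show "0 \<le> real m powr (Re c / 2) * (\<Prod>p\<in>prime_factors m. min 1 (h p))"
        by (intro mult_nonneg_nonneg prod_nonneg) auto
    qed simp
    also have "\<dots> = norm (divisor_sigma c n)"
      unfolding m(1) using p1 m0 by (simp add: divisor_sigma_mult_coprime[OF cop] norm_mult)
    finally show ?thesis .
  qed
qed

text \<open>The finitely many primes with \<open>h p < 1\<close> cost at most a constant factor \<open>K > 0\<close>, whatever \<open>n\<close> is.\<close>
lemma norm_divisor_sigma_at_top:
  assumes a: "Re c > 0"
  shows "filterlim (\<lambda>n. norm (divisor_sigma c n)) at_top sequentially"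
proof -
  define h where "h = (\<lambda>p. real p powr (Re c / 2) * ((real p powr Re c - 1) / (real p powr Re c + 1)))"
  have lim: "filterlim (\<lambda>n. real n powr (Re c / 2)) at_top sequentially"
  proof -
    have "(\<lambda>n. real n powr - (Re c / 2)) \<longlonglongrightarrow> 0"
      using a by (intro tendsto_neg_powr filterlim_real_sequentially) auto
    then have "filterlim (\<lambda>n. inverse (real n powr - (Re c / 2))) at_top sequentially"
      by (rule filterlim_inverse_at_top)
        (use eventually_gt_at_top[of "0::nat"] in \<open>auto elim: eventually_mono\<close>)
    then show ?thesis by (simp add: powr_minus)
  qed
  then have "\<forall>\<^sub>F n in sequentially. real n powr (Re c / 2) \<ge> 2"
    by (simp add: filterlim_at_top)
  (* For y = p powr (a / 2) \<ge> 2 one has y * (y^2 - 1) \<ge> y^2 + 1, that is, h p \<ge> 1. *)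
  then obtain M where M: "\<And>n. n \<ge> M \<Longrightarrow> real n powr (Re c / 2) \<ge> 2"
    by (auto simp: eventually_sequentially)
  have h1: "h p \<ge> 1" if "p \<ge> M" for p
  proof -
    define y where "y = real p powr (Re c / 2)"
    have y: "y \<ge> 2" using M[OF that] by (simp add: y_def)
    have "y ^ 2 \<ge> 2 * y" "y ^ 3 \<ge> 2 * y ^ 2" 
      using y by (auto simp: power2_eq_square power3_eq_cube mult_right_mono)
    then have "y ^ 2 + 1 \<le> y * (y ^ 2 - 1)"
      using y unfolding right_diff_distrib power3_eq_cube power2_eq_square mult_1_right by linarith
    then have "y * ((y ^ 2 - 1) / (y ^ 2 + 1)) \<ge> 1" 
      by (subst times_divide_eq_right, subst le_divide_eq_1_pos) (auto simp: add_nonneg_pos)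
    moreover have "real p powr Re c = y ^ 2" unfolding y_def by (simp add: power2_eq_square flip: powr_add)
    ultimately show ?thesis by (simp add: h_def y_def)
  qed
  have hpos: "h p > 0" if "prime p" for p
  proof -
    have "real p powr Re c > 1" using prime_gt_1_nat[OF that] a by (intro gr_one_powr) auto
    then show ?thesis using prime_gt_0_nat[OF that] by (simp add: h_def)
  qed
  define K where "K = (\<Prod>p | prime p \<and> p < M. min 1 (h p))"
  have K: "K > 0" unfolding K_def by (intro prod_pos) (use hpos in auto)
  have "K * real n powr (Re c / 2) \<le> norm (divisor_sigma c n)" if "n > 0" for n
  proof -
    let ?S = "{p. prime p \<and> p < M}"
    have "K = (\<Prod>p\<in>?S - prime_factors n \<inter> ?S. min 1 (h p)) *
        (\<Prod>p\<in>prime_factors n \<inter> ?S. min 1 (h p))"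
      unfolding K_def by (rule prod.subset_diff) auto
    also have "\<dots> \<le> 1 * (\<Prod>p\<in>prime_factors n \<inter> ?S. min 1 (h p))"
      by (intro mult_right_mono prod_le_1 prod_nonneg) (use hpos in \<open>auto intro: less_imp_le\<close>)
    finally have "K \<le> (\<Prod>p\<in>prime_factors n \<inter> ?S. min 1 (h p))" by simp
    also have "\<dots> = (\<Prod>p\<in>prime_factors n. min 1 (h p))"
      by (rule prod.mono_neutral_left) (auto simp: min_def intro!: antisym h1 dest: hpos)
    finally have "K * real n powr (Re c / 2) \<le> (\<Prod>p\<in>prime_factors n. min 1 (h p)) * real n powr (Re c / 2)"
      by (intro mult_right_mono) auto
    then show ?thesis using norm_divisor_sigma_ge[OF a that] by (simp add: h_def mult.commute)
  qed
  then have "\<forall>\<^sub>F n in sequentially. K * real n powr (Re c / 2) \<le> norm (divisor_sigma c n)"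
    by (intro eventually_sequentiallyI[of 1]) auto
  moreover have "filterlim (\<lambda>n. K * real n powr (Re c / 2)) at_top sequentially"
    by (rule filterlim_tendsto_pos_mult_at_top[OF tendsto_const K lim])
  ultimately show ?thesis by (rule filterlim_at_top_mono[rotated])
qed


lemma not_dense_if_norm_at_top:
  assumes "filterlim (\<lambda>n. norm (divisor_sigma c n)) at_top sequentially"
  shows "closure (sigma_range c) \<noteq> UNIV"
proof
  assume dense: "closure (sigma_range c) = UNIV"
  obtain M where M: "\<And>n. n \<ge> M \<Longrightarrow> norm (divisor_sigma c n) \<ge> 1"
    using assms unfolding filterlim_at_top eventually_sequentially by blast
  have "ball 0 1 \<inter> sigma_range c \<subseteq> divisor_sigma c ` {..<M}"
  proof
    fix z assume "z \<in> ball 0 1 \<inter> sigma_range c"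
    then obtain n where n: "z = divisor_sigma c n" "norm (divisor_sigma c n) < 1"
      by (auto simp: sigma_range_def)
    then have "\<not> n \<ge> M" using M[of n] by linarith
    then show "z \<in> divisor_sigma c ` {..<M}" using n(1) by auto
  qed
  then have fin: "finite (ball 0 1 \<inter> sigma_range c)" by (rule finite_subset) simp
  have "ball 0 1 \<inter> closure (sigma_range c) \<subseteq> closure (ball 0 1 \<inter> sigma_range c)"
    by (rule open_Int_closure_subset) simp
  also have "\<dots> = ball 0 1 \<inter> sigma_range c"
    using fin by (intro closure_closed finite_imp_closed)
  finally have "finite (ball 0 1 \<inter> closure (sigma_range c))"
    using fin by (rule finite_subset)
  then have "finite (ball (0::complex) 1)" by (simp add: dense)
  then show False using uncountable_ball[of 1 "0::complex"] countable_finite by auto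
qed


section \<open>The criterion\<close>

theorem theorem3p1:
  fixes a b :: real and c :: complex
  assumes "c = Complex a b"
  shows "closure (sigma_range c) = UNIV \<longleftrightarrow> (-1 \<le> a \<and> a \<le> 0) \<and> b \<noteq> 0"
proof (intro iffI conjI)
  assume dense: "closure (sigma_range c) = UNIV"
  show "-1 \<le> a"
  proof (rule ccontr)
    assume "\<not> -1 \<le> a"
    then have "bounded (sigma_range c)"
      using norm_divisor_sigma_le[of c] by (auto simp: bounded_iff sigma_range_def assms)
    then show False using not_dense_if_bounded dense by blast
  qed
  show "a \<le> 0"
  proof (rule ccontr)
    assume "\<not> a \<le> 0"
    then show False
      using not_dense_if_norm_at_top[OF norm_divisor_sigma_at_top[of c]] dense by (simp add: assms)
  qed
  show "b \<noteq> 0"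
  proof
    assume "b = 0"
    then have "c = of_real a" by (simp add: assms complex_eq_iff)
    then have "sigma_range c \<subseteq> \<real>"
      by (auto simp: sigma_range_def divisor_sigma_def simp flip: of_real_mult exp_of_real)
    then have "closure (sigma_range c) \<subseteq> \<real>"
      by (rule closure_minimal) (rule closed_complex_Reals)
    then have "\<i> \<in> \<real>" unfolding dense by blast
    then show False by (simp add: complex_is_Real_iff)
  qed
next
  assume ab: "(-1 \<le> a \<and> a \<le> 0) \<and> b \<noteq> 0"
  then have b: "b \<noteq> 0" by simp
  have "z \<in> closure (prime_products c)" if "z \<noteq> 0" for z
  proof (cases "a = 0")
    case True
    show ?thesis
      unfolding assms True by (rule in_closure_prime_products_if_zero[OF that b])
  next
    case False
    with ab have "-1 \<le> a" "a < 0" by auto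
    then show ?thesis
      unfolding assms by (rule in_closure_prime_products_if_neg[OF _ _ that b])
  qed
  then have "- {0} \<subseteq> closure (sigma_range c)"
    using closure_mono[OF prime_products_subset] by blast
  then have "closure (- {0}) \<subseteq> closure (sigma_range c)"
    by (rule closure_minimal) simp
  then show "closure (sigma_range c) = UNIV"
    by (auto simp: closure_complement)
qed

end
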